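(* Let $s\in(0,1)$ and $n\in\mathbb{N}\cup\{0\}$, and let $\lambda_n^s=\frac{\Gamma(2s+n+1)}{n!}$. The weighted operator $(-\Delta)^s_\omega$ in the interval $(-1,1)$ satisfies the identity $$(-\Delta)^s_\omega\big(C_n^{(s+1/2)}\big)=\lambda_n^s\,C_n^{(s+1/2)}.$$ Moreover, for the weighted operator $(-\Delta)^s_\omega$ in a bounded interval $(a,b)$ we have $$(-\Delta)^s_\omega(p_n)=\lambda_n^s\,p_n,\qquad p_n(x)=C_n^{(s+1/2)}\left(\frac{2(x-a)}{b-a}-1\right).$$
   Context: Weighted operator: for $s\in(0,1)$ and a bounded interval $(a,b)$, let $\omega^s(y)=(y-a)^s(b-y)^s$. For $\phi\in C^2(a,b)\cap C^1[a,b]$ (not necessarily vanishing at $a,b$) and $x\in(a,b)$ define $$(-\Delta)^s_\omega[\phi](x)=C_s\frac{d}{dx}\int_a^b|x-y|^{1-2s}\frac{d}{dy}\big(\omega^s(y)\phi(y)\big)\,dy\quad (s\neq 1/2),$$ $$(-\Delta)^{1/2}_\omega[\phi](x)=\frac1\pi\frac{d}{dx}\int_a^b\ln|x-y|\,\frac{d}{dy}\big(\omega^{1/2}(y)\phi(y)\big)\,dy\quad (s=1/2),$$ where $C_s=-\Gamma(2s-1)\sin(\pi s)/\pi$ for $s\neq 1/2$. Gegenbauer polynomials: $C_0^{(\alpha)}(x)=1$, $C_1^{(\alpha)}(x)=2\alpha x$, and $C_n^{(\alpha)}(x)=\frac1n\left[2x(n+\alpha-1)C_{n-1}^{(\alpha)}(x)-(n+2\alpha-2)C_{n-2}^{(\alpha)}(x)\right]$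 for $n\ge2$. *)

theory Defs
  imports "HOL-Analysis.Analysis"
begin

fun gegenbauer :: "real \<Rightarrow> nat \<Rightarrow> real \<Rightarrow> real" where
  "gegenbauer \<alpha> 0 x = 1"
| "gegenbauer \<alpha> (Suc 0) x = 2 * \<alpha> * x"
| "gegenbauer \<alpha> (Suc (Suc n)) x =
     (2 * x * (real (n + 2) + \<alpha> - 1) * gegenbauer \<alpha> (Suc n) x
      - (real (n + 2) + 2 * \<alpha> - 2) * gegenbauer \<alpha> n x) / real (n + 2)"

definition edge_weight :: "real \<Rightarrow> real \<Rightarrow> real \<Rightarrow> real \<Rightarrow> real" where
  "edge_weight s a b y = (y - a) powr s * (b - y) powr s"

definition frac_const :: "real \<Rightarrow> real" where
  "frac_const s = (if s = 1/2 then 1 / pi else - Gamma (2 * s - 1) * sin (pi * s) / pi)"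

(* The value on the diagonal z = 0 (0 in either case) affects the integrals below
   only on a null set. *)
definition frac_kernel :: "real \<Rightarrow> real \<Rightarrow> real" where
  "frac_kernel s z = (if s = 1/2 then ln \<bar>z\<bar> else \<bar>z\<bar> powr (1 - 2 * s))"

definition frac_potential ::
  "real \<Rightarrow> real \<Rightarrow> real \<Rightarrow> (real \<Rightarrow> real) \<Rightarrow> real \<Rightarrow> real" where
  "frac_potential s a b \<phi> x =
     (LBINT y:{a<..<b}. frac_kernel s (x - y) * deriv (\<lambda>y. edge_weight s a b y * \<phi> y) y)"

definition weighted_frac_laplacian ::
  "real \<Rightarrow> real \<Rightarrow> real \<Rightarrow> (real \<Rightarrow> real) \<Rightarrow> real \<Rightarrow> real" where
  "weighted_frac_laplacian s a b \<phi> x = frac_const s * deriv (frac_potential s a b \<phi>) x"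

(* Integrals and derivatives are total functions in HOL, with arbitrary values where they
   do not exist.  This predicate says that those in weighted_frac_laplacian do exist on all
   of (a,b), so that an identity for the operator is not one between arbitrary values. *)
definition weighted_frac_laplacian_defined ::
  "real \<Rightarrow> real \<Rightarrow> real \<Rightarrow> (real \<Rightarrow> real) \<Rightarrow> bool" where
  "weighted_frac_laplacian_defined s a b \<phi> \<longleftrightarrow>
     (\<forall>y\<in>{a<..<b}. (\<lambda>y. edge_weight s a b y * \<phi> y) field_differentiable at y) \<and>
     (\<forall>x\<in>{a<..<b}. set_integrable lborel {a<..<b}
        (\<lambda>y. frac_kernel s (x - y) * deriv (\<lambda>y. edge_weight s a b y * \<phi> y) y)) \<and>
     (\<forall>x\<in>{a<..<b}. frac_potential s a b \<phi> field_differentiable at x)"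

definition frac_eigenvalue :: "real \<Rightarrow> nat \<Rightarrow> real" where
  "frac_eigenvalue s n = Gamma (2 * s + real n + 1) / fact n"

end

theory Submission
  imports Defs
begin

text \<open>
  Let $k$ be the kernel ($|z|^{1-2s}$, or $\ln|z|$ for $s = 1/2$), let $\alpha = s + 1/2$ and $C_n = C_n^{(\alpha)}$. On
  $(-1,1)$ the derivative of $(1-y^2)^s C_n(y)$ is a constant multiple of $(1-y^2)^{s-1} e_n(y)$, where
  $e_n = (C_{n+1} - C_{n-1})/(n+\alpha)$ satisfies $e_n' = 2 C_n$. So the potential of $C_n$ is a multiple of
  $T e_n$, with $T g(x) = \int_{-1}^1 k(x-y)(1-y^2)^{s-1} g(y)\,dy$, and the theorem says that the $e_n$ are
  eigenfunctions of $T$, with the eigenvalues of \<open>riesz_transform_gegenbauer_primitive\<close>.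

  Three facts about $T$ give this. First, $T1$ is constant (\<open>riesz_transform_one\<close>): for
  $s \neq 1/2$ two Moebius substitutions reduce the integral to $B(1-s,s)$, and the logarithm is the limit
  $s \to 1/2$ (\<open>power_kernel_integral\<close>, \<open>log_kernel_integral\<close>). Second, since $z\,k(z)$ is
  a primitive of $(2-2s)\,k(z)$ (plus $1$ for the logarithm), the derivative of $T(yg)$ is determined by
  $Tg$ and, for the logarithm, the weighted integral of $g$ (\<open>riesz_transform_mult_id_has_derivative\<close>). Third, $T$ is symmetric for the weight, so by
  the first fact it preserves orthogonality to constants (\<open>riesz_transform_orthogonal_one\<close>).

  The three-term recurrence expresses $e_{n+1}$ by $y e_n$ and $e_{n-1}$ (by $y e_0$ and $1$ when $n = 0$). By the second fact
  $(T e_{n+1})'$ is the expected multiple of $2 C_{n+1}$, and the third fact shows that the constant of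
  integration is zero, because every $e_n$ is orthogonal to constants. A general interval follows
  by an affine substitution, under which the operator is invariant.
\<close>

section \<open>Derivatives of Gegenbauer polynomials\<close>

lemma gegenbauer_has_derivative_ex: "\<exists>D. (gegenbauer \<alpha> n has_real_derivative D) (at x)"
proof (induction \<alpha> n x rule: gegenbauer.induct)
  case (1 \<alpha> x)
  have "gegenbauer \<alpha> 0 = (\<lambda>x. 1)" by auto
  then show ?case by (auto intro!: exI derivative_eq_intros)
next
  case (2 \<alpha> x)
  have "gegenbauer \<alpha> (Suc 0) = (\<lambda>x. 2 * \<alpha> * x)" by auto
  then show ?case by (auto intro!: exI derivative_eq_intros)
next
  case (3 \<alpha> n x)
  then obtain D1 D2 where "(gegenbauer \<alpha> (Suc n) has_real_derivative D1) (at x)"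
    "(gegenbauer \<alpha> n has_real_derivative D2) (at x)" by blast
  moreover have "gegenbauer \<alpha> (Suc (Suc n)) = (\<lambda>x. (2 * x * (real (n + 2) + \<alpha> - 1) * gegenbauer \<alpha> (Suc n) x
      - (real (n + 2) + 2 * \<alpha> - 2) * gegenbauer \<alpha> n x) / real (n + 2))" by auto
  ultimately show ?case by (auto simp only: intro!: exI derivative_eq_intros)
qed

lemma gegenbauer_has_deriv:
  "(gegenbauer \<alpha> n has_real_derivative deriv (gegenbauer \<alpha> n) x) (at x)"
  using gegenbauer_has_derivative_ex[of \<alpha> n x] by (metis DERIV_imp_deriv)

lemma continuous_on_gegenbauer [continuous_intros]: "continuous_on S (gegenbauer \<alpha> n)"
  by (meson DERIV_isCont continuous_at_imp_continuous_on gegenbauer_has_deriv)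

lemma gegenbauer_rec:
  "real (n + 2) * gegenbauer \<alpha> (Suc (Suc n)) x =
     2 * x * (real n + 1 + \<alpha>) * gegenbauer \<alpha> (Suc n) x - (real n + 2 * \<alpha>) * gegenbauer \<alpha> n x"
  unfolding gegenbauer.simps(3) by (simp add: field_simps del: gegenbauer.simps)

lemma gegenbauer_deriv_rec:
  "real (n + 2) * deriv (gegenbauer \<alpha> (Suc (Suc n))) x =
     2 * (real n + 1 + \<alpha>) * (gegenbauer \<alpha> (Suc n) x + x * deriv (gegenbauer \<alpha> (Suc n)) x)
     - (real n + 2 * \<alpha>) * deriv (gegenbauer \<alpha> n) x"
proof -
  have "((\<lambda>x. (2 * x * (real n + 1 + \<alpha>) * gegenbauer \<alpha> (Suc n) x - (real n + 2 * \<alpha>) * gegenbauer \<alpha> n x))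
     has_real_derivative 2 * (real n + 1 + \<alpha>) * (gegenbauer \<alpha> (Suc n) x + x * deriv (gegenbauer \<alpha> (Suc n)) x)
     - (real n + 2 * \<alpha>) * deriv (gegenbauer \<alpha> n) x) (at x)"
    by (auto intro!: derivative_eq_intros gegenbauer_has_deriv simp: algebra_simps)
  moreover have "((\<lambda>x. real (n + 2) * gegenbauer \<alpha> (Suc (Suc n)) x)
     has_real_derivative real (n + 2) * deriv (gegenbauer \<alpha> (Suc (Suc n))) x) (at x)"
    by (intro DERIV_cmult gegenbauer_has_deriv)
  ultimately show ?thesis
    unfolding gegenbauer_rec by (rule DERIV_unique[rotated])
qed

text \<open>The three identities feed each other, so they are proved by one induction.\<close>
lemma gegenbauer_deriv_identities:
  shows gegenbauer_deriv_Suc: "deriv (gegenbauer \<alpha> (Suc n)) x =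
      x * deriv (gegenbauer \<alpha> n) x + (real n + 2 * \<alpha>) * gegenbauer \<alpha> n x"
    and gegenbauer_deriv_lower: "x * deriv (gegenbauer \<alpha> (Suc n)) x =
      deriv (gegenbauer \<alpha> n) x + (real n + 1) * gegenbauer \<alpha> (Suc n) x"
    and gegenbauer_deriv_weighted: "(1 - x\<^sup>2) * deriv (gegenbauer \<alpha> n) x =
      (real n + 2 * \<alpha>) * x * gegenbauer \<alpha> n x - (real n + 1) * gegenbauer \<alpha> (Suc n) x"
proof (induction n)
  case 0
  have d0: "deriv (gegenbauer \<alpha> 0) x = 0"
  proof (rule DERIV_imp_deriv)
    have "gegenbauer \<alpha> 0 = (\<lambda>x. 1)" by auto
    then show "(gegenbauer \<alpha> 0 has_real_derivative 0) (at x)" by simp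
  qed
  have "gegenbauer \<alpha> (Suc 0) = (\<lambda>x. 2 * \<alpha> * x)" by auto
  then have d1: "deriv (gegenbauer \<alpha> (Suc 0)) x = 2 * \<alpha>"
    by (intro DERIV_imp_deriv) (auto intro!: derivative_eq_intros)
  case 1 show ?case by (simp add: d0 d1)
  case 2 show ?case by (simp add: d0 d1)
  case 3 show ?case by (simp add: d0)
next
  case (Suc n)
  let ?C0 = "gegenbauer \<alpha> n x" and ?C1 = "gegenbauer \<alpha> (Suc n) x" and ?C2 = "gegenbauer \<alpha> (Suc (Suc n)) x"
  let ?D0 = "deriv (gegenbauer \<alpha> n) x" and ?D1 = "deriv (gegenbauer \<alpha> (Suc n)) x"
    and ?D2 = "deriv (gegenbauer \<alpha> (Suc (Suc n))) x"
  have "(real n + 2) * ?D2 = (real n + 2) * (x * ?D1 + (real (Suc n) + 2 * \<alpha>) * ?C1)"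
    using gegenbauer_deriv_rec[of n \<alpha> x] Suc(2)
    unfolding of_nat_add of_nat_Suc of_nat_numeral by algebra
  then have a: "?D2 = x * ?D1 + (real (Suc n) + 2 * \<alpha>) * ?C1"
    by (subst (asm) mult_cancel_left) auto
  have J: "(1 - x\<^sup>2) * ?D1 = (real (Suc n) + 2 * \<alpha>) * x * ?C1 - (real (Suc n) + 1) * ?C2"
    using gegenbauer_rec[of n \<alpha> x] Suc(1,3)
    unfolding of_nat_add of_nat_Suc of_nat_numeral by algebra
  have b: "x * ?D2 = ?D1 + (real (Suc n) + 1) * ?C2"
    using a J by algebra
  case 1 show ?case by (rule a)
  case 2 show ?case by (rule b)
  case 3 show ?case by (rule J)
qed

text \<open>
  \<open>gegenbauer_primitive \<alpha> n\<close> is the primitive $(C_{n+1}^{(\alpha)} - C_{n-1}^{(\alpha)})/(n+\alpha)$ of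
  $2 C_n^{(\alpha)}$, with $C_{-1}^{(\alpha)} = 0$. For $\alpha \neq 1$ it equals
  $C_{n+1}^{(\alpha-1)}/(\alpha-1)$; the present form also makes sense for $\alpha = 1$, where it
  is $2/(n+1)$ times the Chebyshev polynomial $T_{n+1}$.
\<close>
definition gegenbauer_primitive :: "real \<Rightarrow> nat \<Rightarrow> real \<Rightarrow> real" where
  "gegenbauer_primitive \<alpha> n x =
     (gegenbauer \<alpha> (Suc n) x - (if n = 0 then 0 else gegenbauer \<alpha> (n - 1) x)) / (real n + \<alpha>)"

lemma gegenbauer_primitive_0: "\<alpha> > 0 \<Longrightarrow> gegenbauer_primitive \<alpha> 0 x = 2 * x"
  by (simp add: gegenbauer_primitive_def)

lemma gegenbauer_primitive_Suc: "gegenbauer_primitive \<alpha> (Suc n) x =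
     (gegenbauer \<alpha> (Suc (Suc n)) x - gegenbauer \<alpha> n x) / (real n + 1 + \<alpha>)"
  by (simp add: gegenbauer_primitive_def del: gegenbauer.simps)

lemma has_derivative_gegenbauer_primitive:
  assumes "\<alpha> > 0"
  shows "(gegenbauer_primitive \<alpha> n has_real_derivative 2 * gegenbauer \<alpha> n x) (at x)"
proof (cases n)
  case 0
  have "gegenbauer_primitive \<alpha> 0 = (\<lambda>x. 2 * x)"
    using assms by (simp add: gegenbauer_primitive_0 fun_eq_iff)
  then show ?thesis by (auto simp: 0 intro!: derivative_eq_intros)
next
  case (Suc m)
  have "(gegenbauer_primitive \<alpha> n has_real_derivative
      (deriv (gegenbauer \<alpha> (Suc (Suc m))) x - deriv (gegenbauer \<alpha> m) x) / (real m + 1 + \<alpha>)) (at x)"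
    unfolding Suc gegenbauer_primitive_Suc[abs_def]
    by (intro DERIV_cdivide DERIV_diff gegenbauer_has_deriv)
  moreover have "deriv (gegenbauer \<alpha> (Suc (Suc m))) x - deriv (gegenbauer \<alpha> m) x
      = 2 * gegenbauer \<alpha> n x * (real m + 1 + \<alpha>)"
    using gegenbauer_deriv_Suc[of \<alpha> "Suc m" x] gegenbauer_deriv_lower[of x \<alpha> m]
    by (simp add: Suc algebra_simps del: gegenbauer.simps)
  ultimately show ?thesis using assms by simp
qed

lemma continuous_on_gegenbauer_primitive [continuous_intros]:
  "\<alpha> > 0 \<Longrightarrow> continuous_on S (gegenbauer_primitive \<alpha> n)"
  by (meson DERIV_isCont continuous_at_imp_continuous_on has_derivative_gegenbauer_primitive)

text \<open>
  With $\alpha = s + 1/2$ the left-hand side is $(1-x^2)^{1-s}$ times the derivative of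
  $(1-x^2)^s C_n^{(\alpha)}(x)$.
\<close>
lemma gegenbauer_primitive_eq_deriv:
  assumes "\<alpha> > 0"
  shows "(1 - x\<^sup>2) * deriv (gegenbauer \<alpha> n) x - (2 * \<alpha> - 1) * x * gegenbauer \<alpha> n x
    = - (real n + 2 * \<alpha> - 1) * (real n + 1) / 2 * gegenbauer_primitive \<alpha> n x"
proof -
  have 1: "(1 - x\<^sup>2) * deriv (gegenbauer \<alpha> n) x - (2 * \<alpha> - 1) * x * gegenbauer \<alpha> n x
     = (real n + 1) * (x * gegenbauer \<alpha> n x - gegenbauer \<alpha> (Suc n) x)"
    using gegenbauer_deriv_weighted[of x \<alpha> n] by (simp add: algebra_simps del: gegenbauer.simps)
  have 2: "x * gegenbauer \<alpha> n x - gegenbauer \<alpha> (Suc n) x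
     = - (real n + 2 * \<alpha> - 1) / 2 * gegenbauer_primitive \<alpha> n x"
  proof (cases n)
    case 0
    show ?thesis using assms by (simp add: 0 gegenbauer_primitive_0 algebra_simps)
  next
    case (Suc m)
    have "real m + 1 + \<alpha> > 0" using assms by auto
    then show ?thesis
      using gegenbauer_rec[of m \<alpha> x] unfolding Suc gegenbauer_primitive_Suc
      by (simp add: field_simps del: gegenbauer.simps)
  qed
  show ?thesis unfolding 1 2 by (simp add: field_simps)
qed

lemma gegenbauer_primitive_1:
  assumes "\<alpha> > 0"
  shows "gegenbauer_primitive \<alpha> (Suc 0) x = \<alpha> * (x * gegenbauer_primitive \<alpha> 0 x) - 1"
proof -
  have "1 + \<alpha> > 0" using assms by simp
  then show ?thesis using assms by (simp add: gegenbauer_primitive_0 gegenbauer_primitive_Suc field_simps)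
qed

text \<open>
  This is the three-term recurrence for the parameter $\alpha - 1$, written so that it survives at
  $\alpha = 1$.
\<close>
lemma gegenbauer_primitive_rec:
  assumes "\<alpha> > 0"
  shows "(real n + 3) * gegenbauer_primitive \<alpha> (Suc (Suc n)) x =
    2 * (real n + 1 + \<alpha>) * (x * gegenbauer_primitive \<alpha> (Suc n) x)
    - (real n + 2 * \<alpha> - 1) * gegenbauer_primitive \<alpha> n x"
proof (cases n)
  case 0
  have "1 + \<alpha> > 0" "2 + \<alpha> > 0" using assms by auto
  then show ?thesis using assms unfolding 0
    by (simp add: gegenbauer_primitive_0 gegenbauer_primitive_Suc divide_simps) algebra
next
  case (Suc m)
  have p: "real m + 1 + \<alpha> \<noteq> 0" "real m + 2 + \<alpha> \<noteq> 0" "real m + 3 + \<alpha> \<noteq> 0" using assms by auto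
  let ?C = "\<lambda>n. gegenbauer \<alpha> n x"
  have r: "(real m + 4) * ?C (Suc (Suc (Suc (Suc m)))) = 2 * x * (real m + 3 + \<alpha>) * ?C (Suc (Suc (Suc m))) - (real m + 2 + 2 * \<alpha>) * ?C (Suc (Suc m))"
    "(real m + 2) * ?C (Suc (Suc m)) = 2 * x * (real m + 1 + \<alpha>) * ?C (Suc m) - (real m + 2 * \<alpha>) * ?C m"
    using gegenbauer_rec[of "Suc (Suc m)" \<alpha> x] gegenbauer_rec[of m \<alpha> x]
    by (simp_all add: algebra_simps del: gegenbauer.simps)
  have g1: "(real m + 3 + \<alpha>) * gegenbauer_primitive \<alpha> (Suc (Suc (Suc m))) x = ?C (Suc (Suc (Suc (Suc m)))) - ?C (Suc (Suc m))"
   and g2: "(real m + 2 + \<alpha>) * gegenbauer_primitive \<alpha> (Suc (Suc m)) x = ?C (Suc (Suc (Suc m))) - ?C (Suc m)"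
   and g3: "(real m + 1 + \<alpha>) * gegenbauer_primitive \<alpha> (Suc m) x = ?C (Suc (Suc m)) - ?C m"
    unfolding gegenbauer_primitive_Suc using p
    by (auto intro!: nonzero_mult_div_cancel_left simp: add_ac times_divide_eq_right simp del: gegenbauer.simps)
  let ?L = "(real m + 4) * gegenbauer_primitive \<alpha> (Suc (Suc (Suc m))) x -
    (2 * (real m + 2 + \<alpha>) * (x * gegenbauer_primitive \<alpha> (Suc (Suc m)) x)
    - (real m + 2 * \<alpha>) * gegenbauer_primitive \<alpha> (Suc m) x)"
  have "(real m + 3 + \<alpha>) * (real m + 1 + \<alpha>) * ?L = 0"
    using r g1 g2 g3 by algebra
  then have "?L = 0" using p by simp
  then show ?thesis by (simp add: Suc algebra_simps)
qed

section \<open>The power kernel integrated against the weight\<close>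

text \<open>
  Nonnegativity makes gauge integrability absolute, so that no continuity of the integrand is needed;
  the integrands below are singular inside the interval.
\<close>
lemma has_integral_substitution_nonneg:
  fixes f g g' h :: "real \<Rightarrow> real"
  assumes bij: "bij_betw g S T" and S: "S \<in> sets lebesgue"
    and der: "\<And>t. t \<in> S \<Longrightarrow> (g has_field_derivative g' t) (at t)"
    and eq: "\<And>t. t \<in> S \<Longrightarrow> \<bar>g' t\<bar> * f (g t) = h t"
    and nonneg: "\<And>y. y \<in> T \<Longrightarrow> f y \<ge> 0"
  shows "(f has_integral b) T \<longleftrightarrow> (h has_integral b) S"
proof -
  have T: "g ` S = T" using bij by (simp add: bij_betw_def)
  have h0: "h t \<ge> 0" if "t \<in> S" for t
    using that nonneg[of "g t"] T eq[of t] by (metis abs_ge_zero image_eqI mult_nonneg_nonneg)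
  have "(f has_integral b) T \<longleftrightarrow> f absolutely_integrable_on T \<and> integral T f = b"
    using nonneg by (subst absolutely_integrable_on_iff_nonneg) (auto simp: has_integral_iff)
  also have "\<dots> \<longleftrightarrow> (\<lambda>t. \<bar>g' t\<bar> * f (g t)) absolutely_integrable_on S \<and> integral S (\<lambda>t. \<bar>g' t\<bar> * f (g t)) = b"
    unfolding T[symmetric]
    by (rule has_absolute_integral_change_of_variables_1'[OF S, symmetric])
       (use bij in \<open>auto simp: bij_betw_def intro: DERIV_subset[OF der]\<close>)
  also have "\<dots> \<longleftrightarrow> h absolutely_integrable_on S \<and> integral S h = b"
    by (intro arg_cong2[of _ _ _ _ "(\<and>)"] set_integrable_cong arg_cong[where f = "\<lambda>u. u = b"]
        Henstock_Kurzweil_Integration.integral_cong refl eq)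
  also have "\<dots> \<longleftrightarrow> (h has_integral b) S"
    using h0 by (subst absolutely_integrable_on_iff_nonneg) (auto simp: has_integral_iff)
  finally show ?thesis .
qed

lemma moebius_square_bij:
  fixes z :: real assumes z: "0 \<le> z" "z < 1"
  shows "bij_betw (\<lambda>t. t\<^sup>2 * (1 - z) / (1 - z * t\<^sup>2)) {0<..<1} {0<..<1}"
proof (rule bij_betwI[where g = "\<lambda>v. sqrt (v / (1 - z + z * v))"])
  have zt: "z * t\<^sup>2 < 1" if "0 < t" "t < 1" for t :: real
    using z that power_strict_mono[of t 1 2] mult_left_le[of "t\<^sup>2" z] by (auto simp: power2_eq_square)
  have d: "1 - z + z * v > 0" if "0 < v" for v
    using z that by (smt (verit) mult_nonneg_nonneg)
  show "(\<lambda>t. t\<^sup>2 * (1 - z) / (1 - z * t\<^sup>2)) \<in> {0<..<1} \<rightarrow> {0<..<1}"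
  proof
    fix t :: real assume t: "t \<in> {0<..<1}"
    then have "t\<^sup>2 < 1" using power_strict_mono[of t 1 2] by auto
    then show "t\<^sup>2 * (1 - z) / (1 - z * t\<^sup>2) \<in> {0<..<1}"
      using t zt[of t] z by (auto simp: field_simps)
  qed
  show "(\<lambda>v. sqrt (v / (1 - z + z * v))) \<in> {0<..<1} \<rightarrow> {0<..<1}"
  proof
    fix v :: real assume v: "v \<in> {0<..<1}"
    then have "z * v + (1 - v) > z" using z mult_pos_pos[of "1 - z" "1 - v"] by (simp add: algebra_simps)
    then show "sqrt (v / (1 - z + z * v)) \<in> {0<..<1}"
      using v d[of v] by (auto simp: field_simps)
  qed
  show "sqrt (t\<^sup>2 * (1 - z) / (1 - z * t\<^sup>2) / (1 - z + z * (t\<^sup>2 * (1 - z) / (1 - z * t\<^sup>2)))) = t"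
    if t: "t \<in> {0<..<1}" for t
  proof -
    have "1 - z + z * (t\<^sup>2 * (1 - z) / (1 - z * t\<^sup>2)) = (1 - z) / (1 - z * t\<^sup>2)"
      using zt[of t] t by (simp add: field_simps)
    then show ?thesis using zt[of t] t z by simp
  qed
  show "(sqrt (v / (1 - z + z * v)))\<^sup>2 * (1 - z) / (1 - z * (sqrt (v / (1 - z + z * v)))\<^sup>2) = v"
    if v: "v \<in> {0<..<1}" for v
  proof -
    have sq: "(sqrt (v / (1 - z + z * v)))\<^sup>2 = v / (1 - z + z * v)"
      using v d[of v] by simp
    have "1 - z * (v / (1 - z + z * v)) = (1 - z) / (1 - z + z * v)"
      using d[of v] v by (simp add: field_simps)
    then show ?thesis unfolding sq using d[of v] v z by simp
  qed
qed

text \<open>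
  The substitution $v = t^2 (1-z)/(1-zt^2)$ in the Beta integral.
\<close>
lemma moebius_beta_integral:
  fixes s z :: real
  assumes s: "0 < s" "s < 1" and z: "0 \<le> z" "z < 1"
  shows "((\<lambda>t. (1 - z) powr (1 - s) * (2 * (t powr (1 - 2 * s) * (1 - t\<^sup>2) powr (s - 1)) / (1 - z * t\<^sup>2)))
      has_integral Beta (1 - s) s) {0<..<1}"
proof -
  have "((\<lambda>v. v powr (- s) * (1 - v) powr (s - 1)) has_integral Beta (1 - s) s) {0<..<1}"
    using has_integral_Beta_real[of "1 - s" s] s by (simp add: has_integral_Icc_iff_Ioo)
  also have "?this \<longleftrightarrow> ?thesis"
  proof (rule has_integral_substitution_nonneg[OF moebius_square_bij[OF z]])
    fix t :: real assume "t \<in> {0<..<1}"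
    then have t: "0 < t" "t < 1" by auto
    then have t2: "0 < t\<^sup>2" "t\<^sup>2 < 1" using power_strict_mono[of t 1 2] by auto
    have zt: "z * t\<^sup>2 < 1"
      using z t2 mult_left_le[of "t\<^sup>2" z] by auto
    let ?d = "1 - z * t\<^sup>2"
    show "((\<lambda>t. t\<^sup>2 * (1 - z) / (1 - z * t\<^sup>2)) has_field_derivative 2 * t * (1 - z) / ?d\<^sup>2) (at t)"
      using zt by (auto intro!: derivative_eq_intros simp: divide_simps) algebra
    have d: "?d > 0" using zt by simp
    have 1: "1 - t\<^sup>2 * (1 - z) / ?d = (1 - t\<^sup>2) / ?d" using d by (simp add: field_simps)
    have e1: "(t\<^sup>2 * (1 - z) / ?d) powr (-s) = t powr (-2 * s) * (1 - z) powr (-s) * ?d powr s"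
      using t d z by (simp add: powr_mult powr_divide powr_minus_divide powr_powr flip: powr_numeral)
    have e2: "((1 - t\<^sup>2) / ?d) powr (s - 1) = (1 - t\<^sup>2) powr (s - 1) * ?d powr (1 - s)"
      using d t2 by (simp add: powr_divide powr_diff)
    have e3: "?d powr s * ?d powr (1 - s) = ?d" using d by (simp flip: powr_add)
    have e4: "t * t powr (-2 * s) = t powr (1 - 2 * s)"
      using t powr_add[of t 1 "-2 * s"] by simp
    have collect: "2 / D\<^sup>2 * A * B * D * C = B * (2 * (A * C) / D)" if "D > 0" for A B C D :: real
      using that by (simp add: field_simps power2_eq_square)
    have e5: "(1 - z) * (1 - z) powr (-s) = (1 - z) powr (1 - s)"
      using z powr_add[of "1 - z" 1 "-s"] by simp
    have "\<bar>2 * t * (1 - z) / ?d\<^sup>2\<bar> = 2 * t * (1 - z) / ?d\<^sup>2" using t z by simp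
    then have "\<bar>2 * t * (1 - z) / ?d\<^sup>2\<bar> * ((t\<^sup>2 * (1 - z) / ?d) powr (-s) * (1 - t\<^sup>2 * (1 - z) / ?d) powr (s - 1))
      = 2 / ?d\<^sup>2 * (t * t powr (-2 * s)) * ((1 - z) * (1 - z) powr (-s)) * (?d powr s * ?d powr (1 - s)) * (1 - t\<^sup>2) powr (s - 1)"
      unfolding 1 e1 e2 by (simp add: mult_ac)
    also have "\<dots> = (1 - z) powr (1 - s) * (2 * (t powr (1 - 2 * s) * (1 - t\<^sup>2) powr (s - 1)) / ?d)"
      unfolding e3 e4 e5 using collect[of ?d] d by simp
    finally show "\<bar>2 * t * (1 - z) / ?d\<^sup>2\<bar> * ((t\<^sup>2 * (1 - z) / ?d) powr (-s) * (1 - t\<^sup>2 * (1 - z) / ?d) powr (s - 1))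
      = (1 - z) powr (1 - s) * (2 * (t powr (1 - 2 * s) * (1 - t\<^sup>2) powr (s - 1)) / ?d)" .
  qed auto
  finally show ?thesis .
qed

text \<open>
  The Moebius maps $y = (x + \sigma t)/(1 + \sigma x t)$, $\sigma = \pm 1$, send $(0,1)$ to the part of
  $(-1,1)$ on the right, respectively left, of $x$. They turn $|x-y|$ and $1-y^2$ into multiples of $t$ and
  $1-t^2$, which moves the singularity of the kernel to the endpoint $0$.
\<close>
lemma moebius_half_integral:
  fixes s x \<sigma> :: real
  assumes s: "0 < s" "s < 1" and x: "-1 < x" "x < 1" and \<sigma>: "\<sigma> = 1 \<or> \<sigma> = -1"
  shows "((\<lambda>y. \<bar>x - y\<bar> powr (1 - 2 * s) * (1 - y\<^sup>2) powr (s - 1)) has_integral b)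
             (if \<sigma> = 1 then {x<..<1} else {-1<..<x})
    \<longleftrightarrow> ((\<lambda>t. (1 - x\<^sup>2) powr (1 - s) * (t powr (1 - 2 * s) * (1 - t\<^sup>2) powr (s - 1) / (1 + \<sigma> * x * t))) has_integral b) {0<..<1}"
proof (rule has_integral_substitution_nonneg)
  have \<sigma>2: "\<sigma> * \<sigma> = 1" using \<sigma> by auto
  have dpos: "1 + \<sigma> * x * t > 0" if "0 < t" "t < 1" for t
  proof -
    have "\<bar>\<sigma> * x * t\<bar> \<le> \<bar>x\<bar> * 1" unfolding abs_mult using \<sigma> that by (intro mult_mono) auto
    then show ?thesis using x by (auto simp: abs_if split: if_splits)
  qed
  have xy: "1 - x * y > 0" if "-1 < y" "y < 1" for y
  proof -
    have "\<bar>x * y\<bar> \<le> \<bar>x\<bar> * 1" unfolding abs_mult using that by (intro mult_mono) auto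
    then show ?thesis using x by (auto simp: abs_if split: if_splits)
  qed
  let ?T = "if \<sigma> = 1 then {x<..<1} else {-1<..<x}"
  have x2: "x\<^sup>2 < 1" using x by (simp add: abs_square_less_1)
  show "bij_betw (\<lambda>t. (x + \<sigma> * t) / (1 + \<sigma> * x * t)) {0<..<1} ?T"
  proof (rule bij_betwI[where g = "\<lambda>y. \<sigma> * (y - x) / (1 - x * y)"])
    show "(\<lambda>t. (x + \<sigma> * t) / (1 + \<sigma> * x * t)) \<in> {0<..<1} \<rightarrow> ?T"
    proof
      fix t :: real assume "t \<in> {0<..<1}"
      then have t: "0 < t" "t < 1" by auto
      have a: "t * (x * x) < t" using t x2 by (simp add: power2_eq_square)
      have b: "0 < (1 - x) * (1 - t)" "0 < (1 + x) * (1 - t)" using x t by auto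
      show "(x + \<sigma> * t) / (1 + \<sigma> * x * t) \<in> ?T"
        using dpos[OF t] a b \<sigma> by (auto simp: field_simps)
    qed
    show "(\<lambda>y. \<sigma> * (y - x) / (1 - x * y)) \<in> ?T \<rightarrow> {0<..<1}"
    proof
      fix y assume y: "y \<in> ?T"
      have y1: "-1 < y" "y < 1" using y x \<sigma> by (auto split: if_splits)
      have b: "0 < (1 - x) * (1 + y)" "0 < (1 + x) * (1 - y)" using x y1 by auto
      show "\<sigma> * (y - x) / (1 - x * y) \<in> {0<..<1}"
        using \<sigma> y xy[OF y1] b by (auto simp: field_simps split: if_splits)
    qed
    fix t :: real assume "t \<in> {0<..<1}"
    then have t: "0 < t" "t < 1" by auto
    have "1 - x * ((x + \<sigma> * t) / (1 + \<sigma> * x * t)) = (1 - x\<^sup>2) / (1 + \<sigma> * x * t)"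
      using dpos[OF t] by (simp add: field_simps power2_eq_square)
    moreover have "\<sigma> * ((x + \<sigma> * t) / (1 + \<sigma> * x * t) - x) = t * (1 - x\<^sup>2) / (1 + \<sigma> * x * t)"
      using dpos[OF t] \<sigma>2 by (simp add: divide_simps) algebra
    ultimately show "\<sigma> * ((x + \<sigma> * t) / (1 + \<sigma> * x * t) - x) / (1 - x * ((x + \<sigma> * t) / (1 + \<sigma> * x * t))) = t"
      using dpos[OF t] x2 by simp
  next
    fix y assume y: "y \<in> ?T"
    have y1: "-1 < y" "y < 1" using y x \<sigma> by (auto split: if_splits)
    have "x + \<sigma> * (\<sigma> * (y - x) / (1 - x * y)) = y * (1 - x\<^sup>2) / (1 - x * y)"
      using xy[OF y1] \<sigma>2 by (simp add: divide_simps) algebra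
    moreover have "1 + \<sigma> * x * (\<sigma> * (y - x) / (1 - x * y)) = (1 - x\<^sup>2) / (1 - x * y)"
      using xy[OF y1] \<sigma>2 by (simp add: divide_simps) algebra
    ultimately show "(x + \<sigma> * (\<sigma> * (y - x) / (1 - x * y))) / (1 + \<sigma> * x * (\<sigma> * (y - x) / (1 - x * y))) = y"
      using xy[OF y1] x2 by simp
  qed
  fix t :: real assume "t \<in> {0<..<1}"
  then have t: "0 < t" "t < 1" by auto
  then have t2: "0 < t\<^sup>2" "t\<^sup>2 < 1" using power_strict_mono[of t 1 2] by auto
  let ?d = "1 + \<sigma> * x * t"
  have d: "?d > 0" using dpos[OF t] .
  show "((\<lambda>t. (x + \<sigma> * t) / (1 + \<sigma> * x * t)) has_field_derivative \<sigma> * (1 - x\<^sup>2) / ?d\<^sup>2) (at t)"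
  proof -
    have "\<sigma> * ?d - (x + \<sigma> * t) * (\<sigma> * x) = \<sigma> * (1 - x\<^sup>2)" by algebra
    then show ?thesis using d by (auto intro!: derivative_eq_intros simp: power2_eq_square)
  qed
  have 1: "1 - ((x + \<sigma> * t) / ?d)\<^sup>2 = (1 - x\<^sup>2) * (1 - t\<^sup>2) / ?d\<^sup>2"
    using d \<sigma>2 by (simp add: divide_simps) algebra
  have "x - (x + \<sigma> * t) / ?d = - \<sigma> * (t * (1 - x\<^sup>2) / ?d)"
    using d by (simp add: divide_simps) (simp add: algebra_simps power2_eq_square)
  then have 2: "\<bar>x - (x + \<sigma> * t) / ?d\<bar> = t * (1 - x\<^sup>2) / ?d"
    using \<sigma> d t x2 by (auto simp: abs_mult)
  have 3: "\<bar>\<sigma> * (1 - x\<^sup>2) / ?d\<^sup>2\<bar> = (1 - x\<^sup>2) / ?d\<^sup>2" using \<sigma> x2 by (auto simp: abs_mult)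
  let ?X = "1 - x\<^sup>2"
  have X: "?X > 0" using x2 by simp
  have e1: "(t * ?X / ?d) powr (1 - 2 * s) = t powr (1 - 2 * s) * ?X powr (1 - 2 * s) * ?d powr (2 * s - 1)"
    using t d X by (simp add: powr_mult powr_divide powr_diff)
  have e2: "(?X * (1 - t\<^sup>2) / ?d\<^sup>2) powr (s - 1) = ?X powr (s - 1) * (1 - t\<^sup>2) powr (s - 1) * ?d powr (2 - 2 * s)"
    using d t2 X by (simp add: powr_mult powr_divide powr_diff powr_powr flip: powr_numeral)
  have e3: "?d powr (2 * s - 1) * ?d powr (2 - 2 * s) = ?d" using d by (simp flip: powr_add)
  have e5: "?X * ?X powr (1 - 2 * s) * ?X powr (s - 1) = ?X powr (1 - s)"
  proof -
    have "?X = ?X powr 1" using X by simp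
    then show ?thesis using powr_add[of ?X "1 + (1 - 2 * s)" "s - 1"] powr_add[of ?X 1 "1 - 2 * s"] by simp
  qed
  have "\<bar>\<sigma> * ?X / ?d\<^sup>2\<bar> * (\<bar>x - (x + \<sigma> * t) / ?d\<bar> powr (1 - 2 * s) * (1 - ((x + \<sigma> * t) / ?d)\<^sup>2) powr (s - 1))
     = (?X * ?X powr (1 - 2 * s) * ?X powr (s - 1)) * (?d powr (2 * s - 1) * ?d powr (2 - 2 * s)) / ?d\<^sup>2
        * (t powr (1 - 2 * s) * (1 - t\<^sup>2) powr (s - 1))"
    unfolding 1 2 3 e1 e2 by (simp add: mult_ac)
  also have "\<dots> = ?X powr (1 - s) * (t powr (1 - 2 * s) * (1 - t\<^sup>2) powr (s - 1) / ?d)"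
    unfolding e3 e5 using d by (simp add: power2_eq_square)
  finally show "\<bar>\<sigma> * ?X / ?d\<^sup>2\<bar> * (\<bar>x - (x + \<sigma> * t) / ?d\<bar> powr (1 - 2 * s) * (1 - ((x + \<sigma> * t) / ?d)\<^sup>2) powr (s - 1))
     = ?X powr (1 - s) * (t powr (1 - 2 * s) * (1 - t\<^sup>2) powr (s - 1) / ?d)" .
qed auto

text \<open>
  The integral does not depend on $x$. The two halves contribute the factors $1/(1+xt)$ and $1/(1-xt)$,
  whose sum is $2/(1-x^2t^2)$; hence both reduce to one Beta integral. The case $s = 1/2$ is included, but
  there the kernel is constant; the logarithm is treated separately.
\<close>
lemma power_kernel_integral:
  fixes s x :: real
  assumes s: "0 < s" "s < 1" and x: "-1 < x" "x < 1"
  shows "set_integrable lborel {-1<..<1} (\<lambda>y. \<bar>x - y\<bar> powr (1 - 2 * s) * (1 - y\<^sup>2) powr (s - 1))"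
    and "(LBINT y:{-1<..<1}. \<bar>x - y\<bar> powr (1 - 2 * s) * (1 - y\<^sup>2) powr (s - 1)) = Beta (1 - s) s"
proof -
  define P where "P \<sigma> t = (1 - x\<^sup>2) powr (1 - s) * (t powr (1 - 2 * s) * (1 - t\<^sup>2) powr (s - 1) / (1 + \<sigma> * x * t))" for \<sigma> t
  define h where "h = (\<lambda>y. \<bar>x - y\<bar> powr (1 - 2 * s) * (1 - y\<^sup>2) powr (s - 1))"
  have hm: "h \<in> borel_measurable borel" unfolding h_def by measurable
  have x2: "x\<^sup>2 < 1" using x by (simp add: abs_square_less_1)
  have dpos: "1 + \<sigma> * x * t > 0" if "0 < t" "t < 1" "\<sigma> = 1 \<or> \<sigma> = -1" for t \<sigma>
  proof -
    have "\<bar>\<sigma> * x * t\<bar> \<le> \<bar>x\<bar> * 1" unfolding abs_mult using that by (intro mult_mono) auto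
    then show ?thesis using x by (auto simp: abs_if split: if_splits)
  qed
  have P0: "P \<sigma> t \<ge> 0" if "t \<in> {0<..<1}" "\<sigma> = 1 \<or> \<sigma> = -1" for t \<sigma>
    using dpos[of t \<sigma>] that by (auto simp: P_def)
  have PP: "((\<lambda>t. P 1 t + P (-1) t) has_integral Beta (1 - s) s) {0<..<1}"
  proof (rule has_integral_eq[OF _ moebius_beta_integral[OF s, of "x\<^sup>2"]])
    fix t :: real assume t: "t \<in> {0<..<1}"
    have d: "1 + x * t > 0" "1 - x * t > 0" using dpos[of t 1] dpos[of t "-1"] t by auto
    have "1 - x\<^sup>2 * t\<^sup>2 = (1 + x * t) * (1 - x * t)" by (simp add: power2_eq_square algebra_simps)
    then show "(1 - x\<^sup>2) powr (1 - s) * (2 * (t powr (1 - 2 * s) * (1 - t\<^sup>2) powr (s - 1)) / (1 - x\<^sup>2 * t\<^sup>2)) = P 1 t + P (-1) t"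
      using d by (simp add: P_def divide_simps) (simp add: algebra_simps)
  qed (use x2 in auto)
  have Pint: "P \<sigma> integrable_on {0<..<1}" if \<sigma>: "\<sigma> = 1 \<or> \<sigma> = -1" for \<sigma>
  proof (rule measurable_bounded_by_integrable_imp_integrable)
    show "(\<lambda>t. P 1 t + P (-1) t) integrable_on {0<..<1}" using PP by blast
    have "P \<sigma> \<in> borel_measurable lborel" unfolding P_def by measurable
    then show "P \<sigma> \<in> borel_measurable (lebesgue_on {0<..<1})"
      by (intro measurable_restrict_space1 measurable_completion)
    show "norm (P \<sigma> t) \<le> P 1 t + P (- 1) t" if "t \<in> {0<..<1}" for t
      using P0[OF that] \<sigma> by (smt (verit) real_norm_def)
  qed auto
  define b where "b \<sigma> = integral {0<..<1} (P \<sigma>)" for \<sigma>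
  have Pb: "(P \<sigma> has_integral b \<sigma>) {0<..<1}" if \<sigma>: "\<sigma> = 1 \<or> \<sigma> = -1" for \<sigma>
    using Pint[OF that] by (simp add: b_def has_integral_integral)
  have bb: "b 1 + b (-1) = Beta (1 - s) s"
    using has_integral_unique[OF has_integral_add[OF Pb[of 1] Pb[of "-1"]]] PP by simp
  have "(h has_integral b \<sigma>) (if \<sigma> = 1 then {x<..<1} else {-1<..<x})" if "\<sigma> = 1 \<or> \<sigma> = -1" for \<sigma>
    using moebius_half_integral[OF s x that, of "b \<sigma>"] Pb[OF that] unfolding h_def P_def[abs_def] by blast
  from this[of 1] this[of "-1"] have "(h has_integral b 1) {x<..<1}" "(h has_integral b (-1)) {-1<..<x}"
    by simp_all
  then have "(h has_integral b 1) {x..1}" "(h has_integral b (-1)) {-1..x}"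
    by (simp_all add: has_integral_Icc_iff_Ioo)
  then have "(h has_integral (b (-1) + b 1)) {-1..1}"
    using has_integral_combine[of "-1" x 1 h "b (-1)" "b 1"] x by simp
  then have hi: "(h has_integral Beta (1 - s) s) {-1<..<1}"
    using bb by (simp add: has_integral_Icc_iff_Ioo add.commute)
  then have "h absolutely_integrable_on {-1<..<1}"
    by (subst absolutely_integrable_on_iff_nonneg) (auto simp: h_def)
  then have si: "set_integrable lborel {-1<..<1} h"
    unfolding set_integrable_def by (subst (asm) integrable_completion) (use hm in measurable)
  then show "set_integrable lborel {-1<..<1} (\<lambda>y. \<bar>x - y\<bar> powr (1 - 2 * s) * (1 - y\<^sup>2) powr (s - 1))"
    by (simp add: h_def)
  from set_borel_integral_eq_integral(2)[OF si] hi
  show "(LBINT y:{-1<..<1}. \<bar>x - y\<bar> powr (1 - 2 * s) * (1 - y\<^sup>2) powr (s - 1)) = Beta (1 - s) s"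
    by (simp add: h_def integral_unique)
qed

section \<open>The fractional kernel and its logarithmic limit\<close>

lemma frac_kernel_measurable [measurable]: "frac_kernel s \<in> borel_measurable borel"
  unfolding frac_kernel_def[abs_def] by measurable

lemma frac_kernel_minus [simp]: "frac_kernel s (- z) = frac_kernel s z"
  by (simp add: frac_kernel_def)

lemma frac_kernel_commute: "frac_kernel s (x - y) = frac_kernel s (y - x)"
  using frac_kernel_minus[of s "x - y"] by simp

text \<open>
  The kernel has one sign up to a constant on $(-2,2)$: the power is nonnegative, the logarithm is at most
  $\ln 2$. So a bound on integrals of the kernel is a bound on integrals of its absolute value.
\<close>
lemma frac_kernel_abs_le: "\<exists>A B. \<forall>z. \<bar>z\<bar> < 2 \<longrightarrow> \<bar>frac_kernel s z\<bar> \<le> A + B * frac_kernel s z"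
proof (cases "s = 1/2")
  case True
  have "\<bar>ln \<bar>z\<bar>\<bar> \<le> 2 * ln 2 + (-1) * ln \<bar>z\<bar>" if "\<bar>z\<bar> < 2" for z :: real
  proof (cases "z = 0")
    case False
    then have "ln \<bar>z\<bar> \<le> ln 2" using that by (subst ln_le_cancel_iff) auto
    then show ?thesis by (auto simp: abs_if)
  qed auto
  then show ?thesis unfolding frac_kernel_def True by (intro exI[of _ "2 * ln 2"] exI[of _ "-1"]) simp
next
  case False
  then show ?thesis unfolding frac_kernel_def by (intro exI[of _ 0] exI[of _ 1]) simp
qed

lemma abs_mult_ln_le:
  fixes z :: real assumes "\<bar>z\<bar> \<le> 1"
  shows "\<bar>z * ln \<bar>z\<bar>\<bar> \<le> 2 * sqrt \<bar>z\<bar>"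
proof (cases "z = 0")
  case False
  let ?r = "sqrt \<bar>z\<bar>"
  have r: "?r > 0" using False by simp
  have "ln (1 / ?r) \<le> 1 / ?r - 1" using r by (intro ln_le_minus_one) simp
  then have "- ln ?r \<le> 1 / ?r" using r by (simp add: ln_div)
  moreover have "ln \<bar>z\<bar> = 2 * ln ?r" using False by (simp add: ln_sqrt)
  ultimately have "- ln \<bar>z\<bar> \<le> 2 / ?r" by simp
  moreover have "ln \<bar>z\<bar> \<le> 0" using False assms by simp
  ultimately have "\<bar>z\<bar> * \<bar>ln \<bar>z\<bar>\<bar> \<le> \<bar>z\<bar> * (2 / ?r)"
    by (intro mult_left_mono) auto
  also have "\<dots> = 2 * ?r" using r real_sqrt_pow2[of "\<bar>z\<bar>"]
    by (simp add: field_simps power2_eq_square)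
  finally show ?thesis by (simp add: abs_mult)
qed auto

text \<open>
  The function $z\,k(z)$ is a primitive of $(2-2s)\,k(z) + \delta$, with $\delta = 1$ for the logarithm and
  $\delta = 0$ for the power; it is continuous across the singularity of $k$.
\<close>
lemma continuous_on_mult_frac_kernel:
  assumes "0 < s" "s < 1"
  shows "continuous_on UNIV (\<lambda>z. z * frac_kernel s z)"
proof -
  have "isCont (\<lambda>z. z * frac_kernel s z) z" for z
  proof (cases "z = 0")
    case False
    have "isCont (frac_kernel s) z" using False
      by (cases "s = 1/2") (auto simp: frac_kernel_def[abs_def] intro!: continuous_intros)
    then show ?thesis by (intro continuous_intros)
  next
    case True
    have "((\<lambda>z. z * frac_kernel s z) \<longlongrightarrow> 0) (at 0)"
    proof (cases "s = 1/2")
      case half: True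
      show ?thesis
      proof (rule Lim_null_comparison)
        show "((\<lambda>z. 2 * sqrt \<bar>z\<bar>) \<longlongrightarrow> 0) (at (0::real))"
          by (rule tendsto_eq_intros | simp)+
        have "\<forall>\<^sub>F z in at 0. z \<in> {-1<..<1::real}"
          by (rule eventually_at_in_open') auto
        then show "\<forall>\<^sub>F z in at 0. norm (z * frac_kernel s z) \<le> 2 * sqrt \<bar>z\<bar>"
          by eventually_elim (use abs_mult_ln_le in \<open>auto simp: frac_kernel_def half\<close>)
      qed
    next
      case not_half: False
      show ?thesis
      proof (rule Lim_null_comparison)
        have "isCont (\<lambda>z. \<bar>z\<bar> powr (2 - 2 * s)) 0"
        proof -
          have "continuous_on UNIV (\<lambda>z::real. \<bar>z\<bar> powr (2 - 2 * s))"
            using assms by (intro continuous_on_powr' continuous_intros) auto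
          then show ?thesis by (simp add: continuous_on_eq_continuous_at)
        qed
        then show "((\<lambda>z. \<bar>z\<bar> powr (2 - 2 * s)) \<longlongrightarrow> 0) (at (0::real))"
          by (simp add: isCont_def)
        have "norm (z * frac_kernel s z) = \<bar>z\<bar> powr (2 - 2 * s)" for z
          using powr_mult_base[of "\<bar>z\<bar>" "1 - 2 * s"] not_half by (simp add: frac_kernel_def abs_mult)
        then show "\<forall>\<^sub>F z in at 0. norm (z * frac_kernel s z) \<le> \<bar>z\<bar> powr (2 - 2 * s)" by simp
      qed
    qed
    then show ?thesis using True by (simp add: isCont_def)
  qed
  then show ?thesis by (simp add: continuous_at_imp_continuous_on)
qed

lemma has_derivative_mult_frac_kernel:
  assumes "z \<noteq> 0"
  shows "((\<lambda>z. z * frac_kernel s z) has_real_derivative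
           (2 - 2 * s) * frac_kernel s z + (if s = 1/2 then 1 else 0)) (at z)"
proof -
  have pos: "((\<lambda>z. z * frac_kernel s z) has_real_derivative
           (2 - 2 * s) * frac_kernel s z + (if s = 1/2 then 1 else 0)) (at z)" if z: "z > 0" for z
  proof (rule has_field_derivative_transform_within_open[where S = "{0<..}" and f = "\<lambda>z. if s = 1/2 then z * ln z else z powr (2 - 2 * s)"])
    show "((\<lambda>z. if s = 1/2 then z * ln z else z powr (2 - 2 * s)) has_real_derivative
           (2 - 2 * s) * frac_kernel s z + (if s = 1/2 then 1 else 0)) (at z)"
      using z by (auto simp: frac_kernel_def intro!: derivative_eq_intros)
    show "(if s = 1/2 then y * ln y else y powr (2 - 2 * s)) = y * frac_kernel s y" if "y \<in> {0<..}" for y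
      using that powr_mult_base[of y "1 - 2 * s"] by (auto simp: frac_kernel_def)
  qed (use z in auto)
  show ?thesis
  proof (cases "z > 0")
    case False
    then have "- z > 0" using assms by simp
    from DERIV_minus[OF DERIV_chain2[OF pos[OF this] DERIV_minus[OF DERIV_ident]]]
    show ?thesis by (auto simp: add.commute split: if_splits)
  qed (rule pos)
qed

lemma frac_kernel_FTC:
  assumes s: "0 < s" "s < 1" and x: "x1 \<le> x2"
  shows "set_integrable lborel {x1..x2} (\<lambda>t. frac_kernel s (t - y))"
    and "(2 - 2 * s) * (LBINT t:{x1..x2}. frac_kernel s (t - y)) =
      (x2 - y) * frac_kernel s (x2 - y) - (x1 - y) * frac_kernel s (x1 - y) - (if s = 1/2 then x2 - x1 else 0)"
proof -
  let ?k = "\<lambda>t. frac_kernel s (t - y)" and ?\<delta> = "if s = 1/2 then 1 else 0 :: real"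
  have "((\<lambda>t. (2 - 2 * s) * ?k t + ?\<delta>) has_integral ((x2 - y) * ?k x2 - (x1 - y) * ?k x1)) {x1..x2}"
  proof (rule fundamental_theorem_of_calculus_interior_strong[of "{y}"])
    show "continuous_on {x1..x2} (\<lambda>t. (t - y) * ?k t)"
      by (rule continuous_on_compose2[OF continuous_on_mult_frac_kernel[OF s]])
         (auto intro: continuous_intros)
    fix t assume "t \<in> {x1<..<x2} - {y}"
    then have "t - y \<noteq> 0" by auto
    moreover have "((\<lambda>t. t - y) has_real_derivative 1) (at t)" by (auto intro!: derivative_eq_intros)
    ultimately have "((\<lambda>t. (t - y) * ?k t) has_real_derivative ((2 - 2 * s) * ?k t + ?\<delta>) * 1) (at t)"
      by (rule DERIV_chain2[where f = "\<lambda>z. z * frac_kernel s z" and g = "\<lambda>t. t - y",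
            OF has_derivative_mult_frac_kernel])
    then show "((\<lambda>t. (t - y) * ?k t) has_vector_derivative (2 - 2 * s) * ?k t + ?\<delta>) (at t)"
      unfolding has_real_derivative_iff_has_vector_derivative by (simp only: mult_1_right)
  qed (use x in auto)
  from has_integral_diff[OF this has_integral_const_real[of ?\<delta> x1 x2]]
  have "((\<lambda>t. (2 - 2 * s) * ?k t) has_integral ((x2 - y) * ?k x2 - (x1 - y) * ?k x1 - (if s = 1/2 then x2 - x1 else 0))) {x1..x2}"
    using x by (auto split: if_splits)
  then have hi: "(?k has_integral ((x2 - y) * ?k x2 - (x1 - y) * ?k x1 - (if s = 1/2 then x2 - x1 else 0)) / (2 - 2 * s)) {x1..x2}"
    using has_integral_divide[of "\<lambda>t. (2 - 2 * s) * ?k t" _ "{x1..x2}" "2 - 2 * s"] s by simp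
  have "?k absolutely_integrable_on {x1..x2}"
  proof (cases "s = 1/2")
    case True
    show ?thesis
    proof (rule absolutely_integrable_absolutely_integrable_ubound)
      show "?k integrable_on {x1..x2}" using hi by blast
      show "(\<lambda>t. \<bar>t - y\<bar>) absolutely_integrable_on {x1..x2}"
        by (intro absolutely_integrable_continuous_real continuous_intros)
      show "?k t \<le> \<bar>t - y\<bar>" for t
        using ln_le_minus_one[of "\<bar>t - y\<bar>"] by (cases "t = y") (auto simp: frac_kernel_def True)
    qed
  next
    case False
    then show ?thesis using hi
      by (subst absolutely_integrable_on_iff_nonneg) (auto simp: frac_kernel_def)
  qed
  then show si: "set_integrable lborel {x1..x2} ?k"
    unfolding set_integrable_def by (subst (asm) integrable_completion) measurable
  from set_borel_integral_eq_integral(2)[OF si] hi s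
  show "(2 - 2 * s) * (LBINT t:{x1..x2}. ?k t) =
      (x2 - y) * ?k x2 - (x1 - y) * ?k x1 - (if s = 1/2 then x2 - x1 else 0)"
    by (simp add: integral_unique)
qed

lemma
  fixes s :: real
  assumes "0 < s"
  shows jacobi_weight_integrable: "set_integrable lborel {-1<..<1} (\<lambda>y. (1 - y\<^sup>2) powr (s - 1))"
    and jacobi_weight_integral: "(LBINT y:{-1<..<1}. (1 - y\<^sup>2) powr (s - 1)) = 2 * 4 powr (s - 1) * Beta s s"
proof -
  have "((\<lambda>v. v powr (s - 1) * (1 - v) powr (s - 1)) has_integral Beta s s) {0<..<1}"
    using has_integral_Beta_real[of s s] assms by (simp add: has_integral_Icc_iff_Ioo)
  then have "((\<lambda>v. 2 * 4 powr (s - 1) * (v powr (s - 1) * (1 - v) powr (s - 1))) has_integral 2 * 4 powr (s - 1) * Beta s s) {0<..<1}"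
    by (rule has_integral_mult_right)
  also have "?this \<longleftrightarrow> ((\<lambda>y. (1 - y\<^sup>2) powr (s - 1)) has_integral 2 * 4 powr (s - 1) * Beta s s) {-1<..<1::real}"
  proof (rule has_integral_substitution_nonneg[symmetric])
    show "bij_betw (\<lambda>v::real. 2 * v - 1) {0<..<1} {-1<..<1}"
      by (rule bij_betwI[where g = "\<lambda>y. (y + 1) / 2"]) (auto simp: field_simps)
    show "((\<lambda>v::real. 2 * v - 1) has_field_derivative 2) (at t)" for t
      by (auto intro!: derivative_eq_intros)
    fix t :: real assume t: "t \<in> {0<..<1}"
    have "1 - (2 * t - 1)\<^sup>2 = 4 * (t * (1 - t))" by (simp add: power2_eq_square algebra_simps)
    then show "\<bar>2\<bar> * (1 - (2 * t - 1)\<^sup>2) powr (s - 1) = 2 * 4 powr (s - 1) * (t powr (s - 1) * (1 - t) powr (s - 1))"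
      using t by (simp add: powr_mult)
  qed auto
  finally have hi: "((\<lambda>y. (1 - y\<^sup>2) powr (s - 1)) has_integral 2 * 4 powr (s - 1) * Beta s s) {-1<..<1::real}" .
  then have "(\<lambda>y. (1 - y\<^sup>2) powr (s - 1)) absolutely_integrable_on {-1<..<1::real}"
    by (subst absolutely_integrable_on_iff_nonneg) auto
  then show si: "set_integrable lborel {-1<..<1} (\<lambda>y. (1 - y\<^sup>2) powr (s - 1))"
    unfolding set_integrable_def by (subst (asm) integrable_completion) measurable
  show "(LBINT y:{-1<..<1}. (1 - y\<^sup>2) powr (s - 1)) = 2 * 4 powr (s - 1) * Beta s s"
    using set_borel_integral_eq_integral(2)[OF si] hi by (simp add: integral_unique)
qed

text \<open>
  The difference quotient $(r^{-e}-1)/e$ tends to $-\ln r$ as $e \to 0$; this bound is uniform in $e$.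
  The upper half is the concavity of $u^{4e}$ at $u = r^{-1/4}$, the lower half is
  $r^{-e} \ge 1 - e \ln r$.
\<close>
lemma powr_difference_quotient_bound:
  fixes r e :: real
  assumes r: "0 < r" "r < 2" and e: "0 < e" "e \<le> 1/4"
  shows "\<bar>(r powr (- e) - 1) / e\<bar> \<le> 4 * r powr (-1/4)"
proof -
  have "(r powr (-1/4)) powr (4 * e) * 1 powr (1 - 4 * e) \<le> 4 * e * r powr (-1/4) + (1 - 4 * e) * 1"
    by (rule Youngs_inequality_0) (use r e in auto)
  then have "r powr (- e) \<le> 1 + e * (4 * r powr (-1/4))" using e by (simp add: powr_powr)
  then have up: "(r powr (- e) - 1) / e \<le> 4 * r powr (-1/4)" using e by (simp add: field_simps)
  have "r powr (- e) \<ge> 1 - e * ln r"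
    using exp_ge_add_one_self[of "- e * ln r"] r by (simp add: powr_def)
  then have "(r powr (- e) - 1) / e \<ge> - ln r" using e by (simp add: field_simps)
  moreover have "ln r \<le> 1" using ln_le_minus_one[of r] r by simp
  moreover have "1 \<le> 4 * r powr (-1/4)"
  proof -
    have "(1/2::real) = 2 powr (-1)" by (simp add: powr_minus)
    also have "\<dots> \<le> 2 powr (-1/4)" by (intro powr_mono) auto
    also have "\<dots> \<le> r powr (-1/4)" using r by (intro powr_mono2') auto
    finally show ?thesis by simp
  qed
  ultimately show ?thesis using up by linarith
qed

lemma powr_difference_quotient_tendsto:
  fixes r :: real and e :: "nat \<Rightarrow> real"
  assumes r: "0 < r" and e: "e \<longlonglongrightarrow> 0" "\<And>n. e n \<noteq> 0"
  shows "(\<lambda>n. (r powr (- e n) - 1) / e n) \<longlonglongrightarrow> - ln r"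
proof -
  have "((\<lambda>h. r powr (- h)) has_real_derivative - ln r) (at 0)"
    using r by (auto intro!: derivative_eq_intros)
  then have "((\<lambda>h. (r powr (- h) - 1) / h) \<longlongrightarrow> - ln r) (at 0)"
    using r by (simp add: DERIV_def)
  moreover have "filterlim e (at 0) sequentially"
    using e by (simp add: filterlim_at)
  ultimately show ?thesis by (rule filterlim_compose)
qed

text \<open>
  The logarithmic case follows from the power case by letting $s \to 1/2$: the integral of
  $(|x-y|^{-e}-1)/e \cdot (1-y^2)^{(e-1)/2}$ is independent of $x$ for $0 < e < 1$, hence so is its limit.
  The value of the limit is not needed.
\<close>
lemma log_kernel_integral:
  "\<exists>c. \<forall>x\<in>{-1<..<1::real}. set_integrable lborel {-1<..<1} (\<lambda>y. ln \<bar>x - y\<bar> * (1 - y\<^sup>2) powr (1/2 - 1))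
      \<and> (LBINT y:{-1<..<1}. ln \<bar>x - y\<bar> * (1 - y\<^sup>2) powr (1/2 - 1)) = c"
proof -
  define e where "e n = 1 / (real n + 4)" for n
  define w where "w t y = indicator {-1<..<1} y * (1 - y\<^sup>2) powr (t - 1)" for t y :: real
  define F where "F x n y = (\<bar>x - y\<bar> powr (- e n) - 1) / e n * w (1/2 + e n / 2) y" for x n y
  define G where "G x y = - ln \<bar>x - y\<bar> * w (1/2) y" for x y :: real
  have e: "0 < e n" "e n \<le> 1/4" for n by (auto simp: e_def field_simps)
  have e0: "e \<longlonglongrightarrow> 0" unfolding e_def[abs_def]
    using LIMSEQ_ignore_initial_segment[OF lim_1_over_n, of 4] by simp
  define I where "I n = (Beta (1 - (1/2 + e n / 2)) (1/2 + e n / 2) - (LBINT y. w (1/2 + e n / 2) y)) / e n" for n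
  have wint: "integrable lborel (w t)" if "t > 0" for t
    using jacobi_weight_integrable[OF that] by (simp add: w_def[abs_def] set_integrable_def)
  have kint: "integrable lborel (\<lambda>y. \<bar>x - y\<bar> powr (1 - 2 * t) * w t y)"
    and kval: "(LBINT y. \<bar>x - y\<bar> powr (1 - 2 * t) * w t y) = Beta (1 - t) t"
    if "0 < t" "t < 1" "x \<in> {-1<..<1}" for t x
    using power_kernel_integral[of t x] that
    by (simp_all add: w_def[abs_def] set_integrable_def set_lebesgue_integral_def mult_ac)
  have wm [measurable]: "w t \<in> borel_measurable borel" for t unfolding w_def by measurable
  have main: "integrable lborel (G x) \<and> (\<lambda>n. I n) \<longlonglongrightarrow> integral\<^sup>L lborel (G x)"
    if x: "x \<in> {-1<..<1}" for x
  proof -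
    \<comment> \<open>four times the mean of two integrable functions; by Young it dominates $4 |x-y|^{-1/4}(1-y^2)^{-1/2}$\<close>
    define D where "D y = 2 * (w (1/4) y + \<bar>x - y\<bar> powr (1 - 2 * (3/4)) * w (3/4) y)" for y
    have FI: "integral\<^sup>L lborel (F x n) = I n" for n
    proof -
      let ?t = "1/2 + e n / 2"
      have t: "0 < ?t" "?t < 1" using e[of n] by auto
      have "F x n = (\<lambda>y. (\<bar>x - y\<bar> powr (1 - 2 * ?t) * w ?t y - w ?t y) / e n)"
        by (auto simp: F_def field_simps)
      then show ?thesis
        using kint[OF t x] kval[OF t x] wint[OF t(1)] by (simp add: I_def)
    qed
    have neq: "AE y in lborel. y \<noteq> x" by (rule AE_lborel_singleton)
    have Dint: "integrable lborel D"
      unfolding D_def using wint[of "1/4"] kint[OF _ _ x, of "3/4"] by simp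
    have lim: "AE y in lborel. (\<lambda>n. F x n y) \<longlonglongrightarrow> G x y"
      using neq
    proof eventually_elim
      fix y assume y: "y \<noteq> x"
      have "(\<lambda>n. w (1/2 + e n / 2) y) \<longlonglongrightarrow> w (1/2 + 0 / 2) y"
      proof (cases "y \<in> {-1<..<1}")
        case True
        then have "1 - y\<^sup>2 > 0" by (simp add: abs_square_less_1 abs_less_iff)
        then show ?thesis unfolding w_def by (intro tendsto_intros e0) auto
      qed (simp add: w_def)
      then show "(\<lambda>n. F x n y) \<longlonglongrightarrow> G x y"
        unfolding F_def G_def using y e(1)
        by (intro tendsto_mult powr_difference_quotient_tendsto e0) (auto simp: less_imp_neq[THEN not_sym])
    qed
    have bound: "AE y in lborel. norm (F x n y) \<le> D y" for n
      using neq
    proof eventually_elim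
      fix y assume y: "y \<noteq> x"
      show "norm (F x n y) \<le> D y"
      proof (cases "y \<in> {-1<..<1}")
        case True
        define a where "a = \<bar>x - y\<bar>" define b where "b = 1 - y\<^sup>2"
        have a: "0 < a" "a < 2" using x y True by (auto simp: a_def)
        have b: "0 < b" "b \<le> 1" using True by (auto simp: b_def abs_square_less_1 abs_less_iff)
        have "norm (F x n y) = \<bar>(a powr (- e n) - 1) / e n\<bar> * b powr (1/2 + e n / 2 - 1)"
          using True by (simp add: F_def w_def a_def b_def abs_mult)
        also have "\<dots> \<le> (4 * a powr (-1/4)) * b powr (-1/2)"
          using a b e[of n] by (intro mult_mono powr_difference_quotient_bound powr_mono') auto
        also have "\<dots> = 4 * ((b powr (-3/4)) powr (1/2) * (a powr (-1/2) * b powr (-1/4)) powr (1/2))"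
          using a b by (simp add: powr_mult powr_powr flip: powr_add)
        also have "\<dots> \<le> 4 * (1/2 * b powr (-3/4) + 1/2 * (a powr (-1/2) * b powr (-1/4)))"
          using a b by (intro mult_left_mono Youngs_inequality_0) auto
        also have "\<dots> = D y"
          using True by (simp add: D_def w_def a_def b_def)
        finally show ?thesis .
      qed (simp add: F_def D_def w_def)
    qed
    have Gm: "G x \<in> borel_measurable lborel" and Fm: "\<And>n. F x n \<in> borel_measurable lborel"
      unfolding G_def[abs_def] F_def[abs_def] by measurable
    show ?thesis
      using integrable_dominated_convergence[OF Gm Fm Dint lim bound]
        integral_dominated_convergence[OF Gm Fm Dint lim bound] by (simp add: FI)
  qed
  have eq: "(\<lambda>y. indicator {-1<..<1} y *\<^sub>R (ln \<bar>x - y\<bar> * (1 - y\<^sup>2) powr (1/2 - 1))) = (\<lambda>y. - G x y)" for x :: real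
    by (auto simp: G_def w_def)
  show ?thesis
  proof (intro exI[of _ "- integral\<^sup>L lborel (G 0)"] ballI conjI)
    fix x :: real assume x: "x \<in> {-1<..<1}"
    show "set_integrable lborel {-1<..<1} (\<lambda>y. ln \<bar>x - y\<bar> * (1 - y\<^sup>2) powr (1/2 - 1))"
      unfolding set_integrable_def eq using main[OF x] by simp
    have "integral\<^sup>L lborel (G x) = integral\<^sup>L lborel (G 0)"
      using main[OF x] main[of 0] by (auto intro: LIMSEQ_unique)
    then show "(LBINT y:{-1<..<1}. ln \<bar>x - y\<bar> * (1 - y\<^sup>2) powr (1/2 - 1)) = - integral\<^sup>L lborel (G 0)"
      unfolding set_lebesgue_integral_def eq by simp
  qed
qed

section \<open>The weighted Riesz transform\<close>

text \<open>The weight $(1-y^2)^{s-1}$ on $(-1,1)$.\<close>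
definition jacobi_weight :: "real \<Rightarrow> real \<Rightarrow> real" where
  "jacobi_weight s y = (1 - y\<^sup>2) powr (s - 1)"

text \<open>
  The integral operator $T g(x) = \int_{-1}^1 k(x-y)\,(1-y^2)^{s-1} g(y)\,dy$ on functions $g$, where $k$ is the
  kernel of the potential. The weight is part of the operator.
\<close>
definition riesz_transform :: "real \<Rightarrow> (real \<Rightarrow> real) \<Rightarrow> real \<Rightarrow> real" where
  "riesz_transform s g x = (LBINT y:{-1<..<1}. frac_kernel s (x - y) * (jacobi_weight s y * g y))"

lemma jacobi_weight_nonneg: "jacobi_weight s y \<ge> 0"
  by (simp add: jacobi_weight_def)

lemma jacobi_weight_measurable [measurable]: "jacobi_weight s \<in> borel_measurable borel"
  unfolding jacobi_weight_def[abs_def] by measurable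

lemma bounded_on_unit_interval:
  fixes g :: "real \<Rightarrow> real"
  assumes "continuous_on UNIV g"
  shows "\<exists>M\<ge>0. \<forall>y\<in>{-1<..<1}. \<bar>g y\<bar> \<le> M"
proof -
  have "continuous_on {-1..1} g" using assms by (rule continuous_on_subset) simp
  then have "bounded (g ` {-1..1})"
    by (intro compact_imp_bounded compact_continuous_image compact_Icc)
  then obtain M where M: "\<forall>v \<in> g ` {-1..1}. norm v \<le> M"
    unfolding bounded_iff ..
  have "\<bar>g y\<bar> \<le> max M 0" if "y \<in> {-1<..<1}" for y
  proof -
    have "norm (g y) \<le> M" using M that by (intro bspec[OF M] imageI) auto
    then show ?thesis by simp
  qed
  then show ?thesis by (intro exI[of _ "max M 0"]) simp
qed

lemma jacobi_weight_mult_integrable: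
  assumes "0 < s" and g: "continuous_on UNIV g"
  shows "set_integrable lborel {-1<..<1} (\<lambda>y. jacobi_weight s y * g y)"
proof -
  obtain M where M0: "M \<ge> 0" and Mg: "\<forall>y\<in>{-1<..<1}. \<bar>g y\<bar> \<le> M"
    using bounded_on_unit_interval[OF g] by auto
  note M = M0 Mg[rule_format]
  have [measurable]: "g \<in> borel_measurable borel" using g by (rule borel_measurable_continuous_onI)
  have "set_integrable lborel {-1<..<1} (\<lambda>y. jacobi_weight s y * M)"
    using jacobi_weight_integrable[OF assms(1)] by (intro set_integrable_mult_left) (simp add: jacobi_weight_def)
  then show ?thesis
  proof (rule set_integrable_bound)
    show "set_borel_measurable lborel {-1<..<1} (\<lambda>y. jacobi_weight s y * g y)"
      unfolding set_borel_measurable_def by measurable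
    show "AE y in lborel. y \<in> {-1<..<1} \<longrightarrow> norm (jacobi_weight s y * g y) \<le> norm (jacobi_weight s y * M)"
      using M by (auto simp: abs_mult intro!: mult_left_mono)
  qed
qed

lemma riesz_transform_one:
  assumes s: "0 < s" "s < 1"
  shows "\<exists>c. (\<forall>x\<in>{-1<..<1}. set_integrable lborel {-1<..<1} (\<lambda>y. frac_kernel s (x - y) * jacobi_weight s y)
      \<and> riesz_transform s (\<lambda>_. 1) x = c) \<and> (s \<noteq> 1/2 \<longrightarrow> c = Beta (1 - s) s)"
proof (cases "s = 1/2")
  case True
  obtain c where c: "\<forall>x\<in>{-1<..<1::real}. set_integrable lborel {-1<..<1} (\<lambda>y. ln \<bar>x - y\<bar> * (1 - y\<^sup>2) powr (1/2 - 1))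
      \<and> (LBINT y:{-1<..<1}. ln \<bar>x - y\<bar> * (1 - y\<^sup>2) powr (1/2 - 1)) = c"
    using log_kernel_integral ..
  have eq: "frac_kernel s (x - y) * jacobi_weight s y = ln \<bar>x - y\<bar> * (1 - y\<^sup>2) powr (1/2 - 1)" for x y
    by (simp only: frac_kernel_def jacobi_weight_def True if_True refl)
  show ?thesis
  proof (intro exI[of _ c] conjI ballI)
    fix x :: real assume x: "x \<in> {-1<..<1}"
    show "set_integrable lborel {-1<..<1} (\<lambda>y. frac_kernel s (x - y) * jacobi_weight s y)"
      unfolding eq using c x by blast
    show "riesz_transform s (\<lambda>_. 1) x = c"
      unfolding riesz_transform_def mult_1_right eq using c x by blast
  qed (use True in simp)
next
  case False
  then have eq: "frac_kernel s (x - y) * jacobi_weight s y = \<bar>x - y\<bar> powr (1 - 2 * s) * (1 - y\<^sup>2) powr (s - 1)" for x y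
    by (simp only: frac_kernel_def jacobi_weight_def if_False refl)
  show ?thesis
  proof (intro exI[of _ "Beta (1 - s) s"] conjI ballI)
    fix x :: real assume "x \<in> {-1<..<1}"
    then have x: "-1 < x" "x < 1" by auto
    show "set_integrable lborel {-1<..<1} (\<lambda>y. frac_kernel s (x - y) * jacobi_weight s y)"
      unfolding eq by (rule power_kernel_integral(1)[OF s x])
    show "riesz_transform s (\<lambda>_. 1) x = Beta (1 - s) s"
      unfolding riesz_transform_def mult_1_right eq by (rule power_kernel_integral(2)[OF s x])
  qed simp
qed

lemma abs_kernel_integral_bounded:
  assumes s: "0 < s" "s < 1"
  shows "\<exists>M. \<forall>x\<in>{-1<..<1}. set_integrable lborel {-1<..<1} (\<lambda>y. \<bar>frac_kernel s (x - y)\<bar> * jacobi_weight s y)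
    \<and> (LBINT y:{-1<..<1}. \<bar>frac_kernel s (x - y)\<bar> * jacobi_weight s y) \<le> M"
proof -
  obtain c where c': "\<forall>x\<in>{-1<..<1}. set_integrable lborel {-1<..<1} (\<lambda>y. frac_kernel s (x - y) * jacobi_weight s y)
      \<and> riesz_transform s (\<lambda>_. 1) x = c"
    using riesz_transform_one[OF s] by auto
  then have c: "set_integrable lborel {-1<..<1} (\<lambda>y. frac_kernel s (x - y) * jacobi_weight s y)"
    "riesz_transform s (\<lambda>_. 1) x = c" if "x \<in> {-1<..<1}" for x
    using that by simp_all
  obtain A B where AB: "\<And>z. \<bar>z\<bar> < 2 \<Longrightarrow> \<bar>frac_kernel s z\<bar> \<le> A + B * frac_kernel s z"
    using frac_kernel_abs_le by blast
  let ?W = "LBINT y:{-1<..<1}. jacobi_weight s y"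
  have wi: "set_integrable lborel {-1<..<1} (jacobi_weight s)"
    using jacobi_weight_integrable[OF s(1)] by (simp add: jacobi_weight_def[abs_def])
  have "set_integrable lborel {-1<..<1} (\<lambda>y. \<bar>frac_kernel s (x - y)\<bar> * jacobi_weight s y) \<and>
      (LBINT y:{-1<..<1}. \<bar>frac_kernel s (x - y)\<bar> * jacobi_weight s y) \<le> A * ?W + B * c"
    if x: "x \<in> {-1<..<1}" for x
  proof
    show i: "set_integrable lborel {-1<..<1} (\<lambda>y. \<bar>frac_kernel s (x - y)\<bar> * jacobi_weight s y)"
      using set_integrable_abs[OF c(1)[OF x]] by (simp add: abs_mult jacobi_weight_nonneg)
    have j: "set_integrable lborel {-1<..<1} (\<lambda>y. A * jacobi_weight s y)"
      "set_integrable lborel {-1<..<1} (\<lambda>y. B * (frac_kernel s (x - y) * jacobi_weight s y))"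
      using wi c(1)[OF x] by auto
    have "(LBINT y:{-1<..<1}. \<bar>frac_kernel s (x - y)\<bar> * jacobi_weight s y) \<le>
       (LBINT y:{-1<..<1}. A * jacobi_weight s y + B * (frac_kernel s (x - y) * jacobi_weight s y))"
    proof (rule set_integral_mono[OF i set_integral_add(1)[OF j]])
      fix y :: real assume "y \<in> {-1<..<1}"
      then have "\<bar>x - y\<bar> < 2" using x by auto
      then have "\<bar>frac_kernel s (x - y)\<bar> * jacobi_weight s y \<le> (A + B * frac_kernel s (x - y)) * jacobi_weight s y"
        by (intro mult_right_mono AB jacobi_weight_nonneg)
      then show "\<bar>frac_kernel s (x - y)\<bar> * jacobi_weight s y
          \<le> A * jacobi_weight s y + B * (frac_kernel s (x - y) * jacobi_weight s y)"
        by (simp add: algebra_simps)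
    qed
    also have "\<dots> = A * ?W + B * c"
      using c(2)[OF x] by (simp add: set_integral_add(2)[OF j] riesz_transform_def)
    finally show "(LBINT y:{-1<..<1}. \<bar>frac_kernel s (x - y)\<bar> * jacobi_weight s y) \<le> A * ?W + B * c" .
  qed
  then show ?thesis by (intro exI[of _ "A * ?W + B * c"] ballI)
qed

lemma riesz_transform_integrable:
  assumes s: "0 < s" "s < 1" and g: "continuous_on UNIV g" and x: "x \<in> {-1<..<1}"
  shows "set_integrable lborel {-1<..<1} (\<lambda>y. frac_kernel s (x - y) * (jacobi_weight s y * g y))"
proof -
  obtain M where M0: "M \<ge> 0" and Mg: "\<forall>y\<in>{-1<..<1}. \<bar>g y\<bar> \<le> M"
    using bounded_on_unit_interval[OF g] by auto
  note M = M0 Mg[rule_format]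
  have [measurable]: "g \<in> borel_measurable borel" using g by (rule borel_measurable_continuous_onI)
  have "set_integrable lborel {-1<..<1} (\<lambda>y. \<bar>frac_kernel s (x - y)\<bar> * jacobi_weight s y * M)"
    using abs_kernel_integral_bounded[OF s] x by (intro set_integrable_mult_left) auto
  then show ?thesis
  proof (rule set_integrable_bound)
    show "set_borel_measurable lborel {-1<..<1} (\<lambda>y. frac_kernel s (x - y) * (jacobi_weight s y * g y))"
      unfolding set_borel_measurable_def by measurable
    show "AE y in lborel. y \<in> {-1<..<1} \<longrightarrow> norm (frac_kernel s (x - y) * (jacobi_weight s y * g y))
        \<le> norm (\<bar>frac_kernel s (x - y)\<bar> * jacobi_weight s y * M)"
      using M by (auto simp: abs_mult mult.assoc intro!: mult_left_mono)
  qed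
qed

text \<open>
  Absolute integrability on the product comes from the bound on $\int |k(x-y)| (1-y^2)^{s-1}\,dy$ that is
  uniform in $x$.
\<close>
lemma riesz_transform_fubini:
  assumes s: "0 < s" "s < 1" and g: "continuous_on UNIV g"
    and h: "set_integrable lborel A h" and A: "A \<subseteq> {-1<..<1}" "A \<in> sets borel" and hm [measurable]: "h \<in> borel_measurable borel"
  shows "(LBINT x:A. h x * riesz_transform s g x)
    = (LBINT y:{-1<..<1}. (LBINT x:A. h x * frac_kernel s (x - y)) * (jacobi_weight s y * g y))"
proof -
  note [measurable] = A(2)
  obtain M where M0: "M \<ge> 0" and Mg: "\<forall>y\<in>{-1<..<1}. \<bar>g y\<bar> \<le> M"
    using bounded_on_unit_interval[OF g] by auto
  note M = M0 Mg[rule_format]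
  have [measurable]: "g \<in> borel_measurable borel" using g by (rule borel_measurable_continuous_onI)
  obtain N where N': "\<forall>x\<in>{-1<..<1}. set_integrable lborel {-1<..<1} (\<lambda>y. \<bar>frac_kernel s (x - y)\<bar> * jacobi_weight s y)
    \<and> (LBINT y:{-1<..<1}. \<bar>frac_kernel s (x - y)\<bar> * jacobi_weight s y) \<le> N"
    using abs_kernel_integral_bounded[OF s] ..
  note N = N'[rule_format, THEN conjunct1] N'[rule_format, THEN conjunct2]
  define f where "f x y = (indicator A x * h x) * (indicator {-1<..<1} y * (frac_kernel s (x - y) * (jacobi_weight s y * g y)))" for x y
  have fm [measurable]: "(\<lambda>(x, y). f x y) \<in> borel_measurable (lborel \<Otimes>\<^sub>M lborel)"
    unfolding f_def by measurable
  have fi: "integrable lborel (f x)" for x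
  proof (cases "x \<in> A")
    case True
    then show ?thesis using riesz_transform_integrable[OF s g, of x] A(1)
      unfolding f_def[abs_def] set_integrable_def by (intro integrable_mult_right) auto
  qed (simp add: f_def[abs_def])
  have "integrable (lborel \<Otimes>\<^sub>M lborel) (\<lambda>(x, y). f x y)"
  proof (rule lborel_pair.Fubini_integrable)
    show "AE x in lborel. integrable lborel (\<lambda>y. case (x, y) of (x, y) \<Rightarrow> f x y)"
      using fi by simp
    show "integrable lborel (\<lambda>x. LBINT y. norm (case (x, y) of (x, y) \<Rightarrow> f x y))"
    proof (rule Bochner_Integration.integrable_bound)
      show "integrable lborel (\<lambda>x. (indicator A x *\<^sub>R h x) * (N * M))"
        using h unfolding set_integrable_def by (intro integrable_mult_left)
      show "(\<lambda>x. LBINT y. norm (case (x, y) of (x, y) \<Rightarrow> f x y)) \<in> borel_measurable lborel"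
        by measurable
      have le: "(LBINT y. \<bar>f x y\<bar>) \<le> \<bar>indicator A x * h x\<bar> * (N * M)" for x
      proof (cases "x \<in> A")
        case True
        then have x: "x \<in> {-1<..<1}" using A by auto
        have i: "integrable lborel (\<lambda>y. \<bar>h x\<bar> * M * (indicator {-1<..<1} y *\<^sub>R (\<bar>frac_kernel s (x - y)\<bar> * jacobi_weight s y)))"
          using N(1)[OF x] unfolding set_integrable_def by (rule integrable_mult_right)
        have "(LBINT y. \<bar>f x y\<bar>) \<le> (LBINT y. \<bar>h x\<bar> * M * (indicator {-1<..<1} y *\<^sub>R (\<bar>frac_kernel s (x - y)\<bar> * jacobi_weight s y)))"
        proof (rule integral_mono[OF integrable_abs[OF fi] i])
          fix y
          show "\<bar>f x y\<bar> \<le> \<bar>h x\<bar> * M * (indicator {-1<..<1} y *\<^sub>R (\<bar>frac_kernel s (x - y)\<bar> * jacobi_weight s y))"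
          proof (cases "y \<in> {-1<..<1}")
            case y: True
            have "\<bar>f x y\<bar> = \<bar>h x\<bar> * (\<bar>frac_kernel s (x - y)\<bar> * jacobi_weight s y) * \<bar>g y\<bar>"
              using True y by (simp add: f_def abs_mult jacobi_weight_nonneg)
            also have "\<dots> \<le> \<bar>h x\<bar> * (\<bar>frac_kernel s (x - y)\<bar> * jacobi_weight s y) * M"
              using M(2)[OF y] by (intro mult_left_mono mult_nonneg_nonneg) (auto simp: jacobi_weight_nonneg)
            finally show ?thesis using y by (simp add: mult_ac)
          qed (simp add: f_def)
        qed
        also have "\<dots> = \<bar>h x\<bar> * M * (LBINT y:{-1<..<1}. \<bar>frac_kernel s (x - y)\<bar> * jacobi_weight s y)"
          unfolding set_lebesgue_integral_def by (rule integral_mult_right_zero)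
        also have "\<dots> \<le> \<bar>h x\<bar> * M * N"
          using N(2)[OF x] M(1) by (intro mult_left_mono) auto
        finally show ?thesis using True by (simp add: mult_ac)
      qed (simp add: f_def)
      have "\<bar>LBINT y. \<bar>f x y\<bar>\<bar> \<le> \<bar>indicator A x * h x * (N * M)\<bar>" for x
      proof -
        have "\<bar>LBINT y. \<bar>f x y\<bar>\<bar> = (LBINT y. \<bar>f x y\<bar>)" by (simp add: integral_nonneg_AE)
        also note le
        also have "\<bar>indicator A x * h x\<bar> * (N * M) \<le> \<bar>indicator A x * h x * (N * M)\<bar>"
          unfolding abs_mult[of _ "N * M"] by (intro mult_left_mono) auto
        finally show ?thesis .
      qed
      then show "AE x in lborel. norm (LBINT y. norm (case (x, y) of (x, y) \<Rightarrow> f x y)) \<le> norm ((indicator A x *\<^sub>R h x) * (N * M))"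
        by simp
    qed
  qed measurable
  from lborel_pair.Fubini_integral[OF this]
  have "(LBINT x. LBINT y. f x y) = (LBINT y. LBINT x. f x y)" by simp
  also have "(LBINT x. LBINT y. f x y) = (LBINT x:A. h x * riesz_transform s g x)"
  proof -
    have "(LBINT y. f x y) = (indicator A x * h x) * (LBINT y. indicator {-1<..<1} y * (frac_kernel s (x - y) * (jacobi_weight s y * g y)))" for x
      unfolding f_def by (rule integral_mult_right_zero)
    then show ?thesis
      by (simp only: riesz_transform_def set_lebesgue_integral_def real_scaleR_def mult.assoc)
  qed
  also have "(LBINT y. LBINT x. f x y) = (LBINT y:{-1<..<1}. (LBINT x:A. h x * frac_kernel s (x - y)) * (jacobi_weight s y * g y))"
  proof -
    have f2: "f x y = (indicator A x * (h x * frac_kernel s (x - y))) * (indicator {-1<..<1} y * (jacobi_weight s y * g y))" for x y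
      unfolding f_def by (simp only: mult_ac)
    have "(LBINT x. f x y) = (LBINT x. indicator A x * (h x * frac_kernel s (x - y))) * (indicator {-1<..<1} y * (jacobi_weight s y * g y))" for y
      unfolding f2 by (rule integral_mult_left_zero)
    then show ?thesis
      by (simp only: set_lebesgue_integral_def real_scaleR_def mult.left_commute)
  qed
  finally show ?thesis .
qed

section \<open>Gegenbauer eigenfunctions of the Riesz transform\<close>

lemma riesz_transform_linear:
  assumes s: "0 < s" "s < 1" and f: "continuous_on UNIV f" and g: "continuous_on UNIV g" and x: "x \<in> {-1<..<1}"
  shows "riesz_transform s (\<lambda>y. a * f y + b * g y) x = a * riesz_transform s f x + b * riesz_transform s g x"
proof -
  have "riesz_transform s (\<lambda>y. a * f y + b * g y) x =
      (LBINT y:{-1<..<1}. a * (frac_kernel s (x - y) * (jacobi_weight s y * f y)) + b * (frac_kernel s (x - y) * (jacobi_weight s y * g y)))"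
    unfolding riesz_transform_def by (simp add: algebra_simps)
  also have "\<dots> = a * riesz_transform s f x + b * riesz_transform s g x"
    using riesz_transform_integrable[OF s f x] riesz_transform_integrable[OF s g x]
    by (simp add: riesz_transform_def set_integral_add(2))
  finally show ?thesis .
qed

lemma riesz_transform_linear_has_derivative:
  assumes s: "0 < s" "s < 1" and f: "continuous_on UNIV f" and g: "continuous_on UNIV g" and x: "x \<in> {-1<..<1}"
    and f': "(riesz_transform s f has_real_derivative f') (at x)"
    and g': "(riesz_transform s g has_real_derivative g') (at x)"
  shows "(riesz_transform s (\<lambda>y. a * f y + b * g y) has_real_derivative a * f' + b * g') (at x)"
proof (rule has_field_derivative_transform_within_open[where S = "{-1<..<1}"])
  show "((\<lambda>z. a * riesz_transform s f z + b * riesz_transform s g z) has_real_derivative a * f' + b * g') (at x)"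
    by (intro DERIV_add DERIV_cmult f' g')
  show "a * riesz_transform s f z + b * riesz_transform s g z = riesz_transform s (\<lambda>y. a * f y + b * g y) z"
    if "z \<in> {-1<..<1}" for z
    by (rule riesz_transform_linear[OF s f g that, symmetric])
qed (use x in auto)

text \<open>
  The commutation rule $(x\,Tg - T(yg))' = (2-2s)\,Tg + \delta \int (1-y^2)^{s-1} g$, solved for $T(yg)'$.
  The function $x\,Tg(x) - T(yg)(x)$ is the integral operator with kernel $(x-y)\,k(x-y)$, whose derivative is
  known. No differentiation under a singular integral takes place: the increments are written as double
  integrals by Fubini, and the continuity of $Tg = P$ gives the derivative.
\<close>
lemma riesz_transform_mult_id_has_derivative:
  assumes s: "0 < s" "s < 1" and g: "continuous_on UNIV g"
    and P: "continuous_on UNIV P" "\<And>x. x \<in> {-1<..<1} \<Longrightarrow> riesz_transform s g x = P x"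
    and x: "x \<in> {-1<..<1}" and P': "(P has_real_derivative P') (at x)"
  shows "(riesz_transform s (\<lambda>y. y * g y) has_real_derivative
      x * P' + (2 * s - 1) * P x - (if s = 1/2 then LBINT y:{-1<..<1}. jacobi_weight s y * g y else 0)) (at x)"
proof -
  define m where "m = (LBINT y:{-1<..<1}. jacobi_weight s y * g y)"
  define \<delta> where "\<delta> = (if s = 1/2 then 1 else 0 :: real)"
  let ?Q = "riesz_transform s (\<lambda>y. y * g y)"
  have yg: "continuous_on UNIV (\<lambda>y. y * g y)" using g by (intro continuous_intros)
  obtain R where R: "\<And>x. x \<in> {-1..1} \<Longrightarrow> (R has_vector_derivative P x) (at x within {-1..1})"
    using antiderivative_continuous[OF continuous_on_subset[OF P(1) subset_UNIV], of "-1" 1] by blast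
  have incr: "(2 - 2 * s) * (R x2 - R x1) = x2 * P x2 - ?Q x2 - (x1 * P x1 - ?Q x1) - \<delta> * m * (x2 - x1)"
    if x12: "-1 < x1" "x1 \<le> x2" "x2 < 1" for x1 x2
  proof -
    have "(P has_integral (R x2 - R x1)) {x1..x2}"
      using x12 by (intro fundamental_theorem_of_calculus has_vector_derivative_within_subset[OF R]) auto
    moreover have "set_integrable lborel {x1..x2} P"
      by (rule borel_integrable_atLeastAtMost'[OF continuous_on_subset[OF P(1)]]) simp
    ultimately have "R x2 - R x1 = (LBINT t:{x1..x2}. P t)"
      by (simp add: set_borel_integral_eq_integral(2) integral_unique)
    also have "\<dots> = (LBINT t:{x1..x2}. 1 * riesz_transform s g t)"
      using x12 P(2) by (intro set_lebesgue_integral_cong) auto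
    also have "\<dots> = (LBINT y:{-1<..<1}. (LBINT t:{x1..x2}. 1 * frac_kernel s (t - y)) * (jacobi_weight s y * g y))"
    proof (rule riesz_transform_fubini[OF s g])
      show "set_integrable lborel {x1..x2} (\<lambda>_. 1::real)"
        by (rule borel_integrable_atLeastAtMost') (rule continuous_on_const)
    qed (use x12 in auto)
    finally have eq: "R x2 - R x1 = (LBINT y:{-1<..<1}. (LBINT t:{x1..x2}. frac_kernel s (t - y)) * (jacobi_weight s y * g y))"
      by (simp only: mult_1_left)
    have "(2 - 2 * s) * (R x2 - R x1)
      = (LBINT y:{-1<..<1}. ((2 - 2 * s) * (LBINT t:{x1..x2}. frac_kernel s (t - y))) * (jacobi_weight s y * g y))"
      unfolding eq mult.assoc set_integral_mult_right by (rule refl)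
    also have "\<dots> = (LBINT y:{-1<..<1}.
        ((x2 * (frac_kernel s (x2 - y) * (jacobi_weight s y * g y)) - frac_kernel s (x2 - y) * (jacobi_weight s y * (y * g y)))
        - (x1 * (frac_kernel s (x1 - y) * (jacobi_weight s y * g y)) - frac_kernel s (x1 - y) * (jacobi_weight s y * (y * g y))))
        - \<delta> * (x2 - x1) * (jacobi_weight s y * g y))"
    proof -
      have d: "(if s = 1/2 then x2 - x1 else 0) = \<delta> * (x2 - x1)" by (simp add: \<delta>_def)
      have ring: "((x2 - y) * k2 - (x1 - y) * k1 - \<delta> * (x2 - x1)) * (w * v)
        = ((x2 * (k2 * (w * v)) - k2 * (w * (y * v))) - (x1 * (k1 * (w * v)) - k1 * (w * (y * v)))) - \<delta> * (x2 - x1) * (w * v)"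
        for y k1 k2 w v :: real by algebra
      show ?thesis unfolding frac_kernel_FTC(2)[OF s x12(2)] d ring by (rule refl)
    qed
    also have "\<dots> = x2 * P x2 - ?Q x2 - (x1 * P x1 - ?Q x1) - \<delta> * m * (x2 - x1)"
    proof -
      have mem: "x1 \<in> {-1<..<1}" "x2 \<in> {-1<..<1}" using x12 by auto
      note i = riesz_transform_integrable[OF s g] riesz_transform_integrable[OF s yg]
        jacobi_weight_mult_integrable[OF s(1) g]
      have j: "set_integrable lborel {-1<..<1} (\<lambda>y. z * (frac_kernel s (z - y) * (jacobi_weight s y * g y)) - frac_kernel s (z - y) * (jacobi_weight s y * (y * g y)))"
        and jv: "(LBINT y:{-1<..<1}. z * (frac_kernel s (z - y) * (jacobi_weight s y * g y)) - frac_kernel s (z - y) * (jacobi_weight s y * (y * g y))) = z * P z - ?Q z"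
        if "z \<in> {-1<..<1}" for z
      proof -
        have i1: "set_integrable lborel {-1<..<1} (\<lambda>y. z * (frac_kernel s (z - y) * (jacobi_weight s y * g y)))"
          using i(1)[OF that] by (rule set_integrable_mult_right)
        show "set_integrable lborel {-1<..<1} (\<lambda>y. z * (frac_kernel s (z - y) * (jacobi_weight s y * g y)) - frac_kernel s (z - y) * (jacobi_weight s y * (y * g y)))"
          by (rule set_integral_diff(1)[OF i1 i(2)[OF that]])
        show "(LBINT y:{-1<..<1}. z * (frac_kernel s (z - y) * (jacobi_weight s y * g y)) - frac_kernel s (z - y) * (jacobi_weight s y * (y * g y))) = z * P z - ?Q z"
          unfolding set_integral_diff(2)[OF i1 i(2)[OF that]] set_integral_mult_right P(2)[OF that, symmetric]
          by (simp only: riesz_transform_def)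
      qed
      have k: "set_integrable lborel {-1<..<1} (\<lambda>y. \<delta> * (x2 - x1) * (jacobi_weight s y * g y))"
        using i(3) by (rule set_integrable_mult_right)
      note d = set_integral_diff[OF j[OF mem(2)] j[OF mem(1)]]
      show ?thesis
        unfolding set_integral_diff(2)[OF d(1) k] d(2) jv[OF mem(1)] jv[OF mem(2)] set_integral_mult_right
        by (simp add: m_def)
    qed
    finally show ?thesis .
  qed
  define G where "G z = z * P z - (2 - 2 * s) * R z - \<delta> * m * z" for z
  have Qeq: "?Q z = G z + (?Q 0 - G 0)" if z: "z \<in> {-1<..<1}" for z
  proof (cases "z \<ge> 0")
    case True
    have "q = w - a * u - d * z + (q0 - (0 * p0 - a * v - d * 0))"
      if "a * (u - v) = w - q - (0 * p0 - q0) - d * (z - 0)" for a u v w q q0 p0 d :: real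
      using that by (simp add: algebra_simps)
    from this[OF incr[of 0 z]] show ?thesis using True z unfolding G_def by simp
  next
    case False
    have "q = w - a * u - d * z + (q0 - (0 * p0 - a * v - d * 0))"
      if "a * (v - u) = 0 * p0 - q0 - (w - q) - d * (0 - z)" for a u v w q q0 p0 d :: real
      using that by (simp add: algebra_simps)
    from this[OF incr[of z 0]] show ?thesis using False z unfolding G_def by simp
  qed
  have R': "(R has_real_derivative P x) (at x)"
    using R[of x] x at_within_Icc_at[of "-1" x 1] by (simp add: has_real_derivative_iff_has_vector_derivative)
  have "((\<lambda>z. G z + (?Q 0 - G 0)) has_real_derivative
      1 * P x + P' * x - (2 - 2 * s) * P x - \<delta> * m + 0) (at x)"
    unfolding G_def[abs_def]
    by (intro DERIV_add[OF _ DERIV_const] DERIV_diff[OF _ DERIV_cmult_Id]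
        DERIV_diff[OF DERIV_mult[OF DERIV_ident P'] DERIV_cmult[OF R']])
  then have "((\<lambda>z. G z + (?Q 0 - G 0)) has_real_derivative
      x * P' + (2 * s - 1) * P x - \<delta> * m) (at x)"
    by (rule DERIV_cong) (simp add: algebra_simps)
  then have "(?Q has_real_derivative x * P' + (2 * s - 1) * P x - \<delta> * m) (at x)"
    by (rule has_field_derivative_transform_within_open[where S = "{-1<..<1}", OF _ _ x Qeq[symmetric]]) simp
  moreover have "\<delta> * m = (if s = 1/2 then LBINT y:{-1<..<1}. jacobi_weight s y * g y else 0)"
    by (simp add: \<delta>_def m_def)
  ultimately show ?thesis by (simp only:)
qed

text \<open>
  Since $T$ is symmetric for the weight and $T1$ is constant, it preserves orthogonality to constants.
\<close>
lemma riesz_transform_orthogonal_one: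
  assumes s: "0 < s" "s < 1" and g: "continuous_on UNIV g"
    and zero: "(LBINT y:{-1<..<1}. jacobi_weight s y * g y) = 0"
  shows "(LBINT x:{-1<..<1}. jacobi_weight s x * riesz_transform s g x) = 0"
proof -
  obtain c where c: "riesz_transform s (\<lambda>_. 1) x = c" if "x \<in> {-1<..<1}" for x
    using riesz_transform_one[OF s] by blast
  have "(LBINT x:{-1<..<1}. jacobi_weight s x * riesz_transform s g x)
    = (LBINT y:{-1<..<1}. (LBINT x:{-1<..<1}. jacobi_weight s x * frac_kernel s (x - y)) * (jacobi_weight s y * g y))"
    using jacobi_weight_integrable[OF s(1)]
    by (intro riesz_transform_fubini s g) (auto simp: jacobi_weight_def)
  also have "\<dots> = (LBINT y:{-1<..<1}. c * (jacobi_weight s y * g y))"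
  proof (intro set_lebesgue_integral_cong allI impI)
    fix y :: real assume "y \<in> {-1<..<1}"
    from c[OF this] have "(LBINT x:{-1<..<1}. jacobi_weight s x * frac_kernel s (x - y)) = c"
      by (simp add: riesz_transform_def frac_kernel_commute[of s y] mult.commute)
    then show "(LBINT x:{-1<..<1}. jacobi_weight s x * frac_kernel s (x - y)) * (jacobi_weight s y * g y) = c * (jacobi_weight s y * g y)"
      by simp
  qed simp
  also have "\<dots> = 0" by (simp add: zero)
  finally show ?thesis .
qed

lemma jacobi_weight_integral_pos:
  assumes s: "0 < s" "s < 1"
  shows "(LBINT y:{-1<..<1}. jacobi_weight s y) > 0"
  using jacobi_weight_integral[OF s(1)] s Gamma_real_pos[of s] Gamma_real_pos[of "s + s"]
  by (simp add: jacobi_weight_def Beta_def)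

lemma weighted_gegenbauer_has_derivative:
  assumes s: "0 < s" and y: "y \<in> {-1<..<1}"
  shows "((\<lambda>y. (1 - y\<^sup>2) powr s * gegenbauer (s + 1/2) n y) has_real_derivative
     - (real n + 2 * s) * (real n + 1) / 2 * (jacobi_weight s y * gegenbauer_primitive (s + 1/2) n y)) (at y)"
proof -
  let ?C = "gegenbauer (s + 1/2) n"
  have p: "1 - y\<^sup>2 > 0" using y by (simp add: abs_square_less_1 abs_less_iff)
  have "((\<lambda>y. (1 - y\<^sup>2) powr s * ?C y) has_real_derivative
      jacobi_weight s y * ((1 - y\<^sup>2) * deriv ?C y - 2 * s * y * ?C y)) (at y)"
  proof -
    have "((\<lambda>y. (1 - y\<^sup>2) powr s) has_real_derivative s * (1 - y\<^sup>2) powr (s - 1) * (- 2 * y)) (at y)"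
      using p by (auto intro!: derivative_eq_intros)
    from DERIV_mult[OF this gegenbauer_has_deriv[of "s + 1/2" n y]]
    have "((\<lambda>y. (1 - y\<^sup>2) powr s * ?C y) has_real_derivative
      s * (1 - y\<^sup>2) powr (s - 1) * (- 2 * y) * ?C y + deriv ?C y * (1 - y\<^sup>2) powr s) (at y)" .
    moreover have "(1 - y\<^sup>2) powr s = (1 - y\<^sup>2) * (1 - y\<^sup>2) powr (s - 1)"
      using powr_mult_base[of "1 - y\<^sup>2" "s - 1"] p by simp
    ultimately show ?thesis by (simp add: jacobi_weight_def algebra_simps)
  qed
  also have "(1 - y\<^sup>2) * deriv ?C y - 2 * s * y * ?C y
      = - (real n + 2 * s) * (real n + 1) / 2 * gegenbauer_primitive (s + 1/2) n y"
    using gegenbauer_primitive_eq_deriv[of "s + 1/2" y n] s by simp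
  finally show ?thesis by (simp add: mult_ac)
qed

text \<open>
  The integrand is, up to a nonzero factor, the derivative of $(1-y^2)^s C_n(y)$, which vanishes at $\pm 1$.
\<close>
lemma gegenbauer_primitive_orthogonal_one:
  assumes s: "0 < s"
  shows "(LBINT y:{-1<..<1}. jacobi_weight s y * gegenbauer_primitive (s + 1/2) n y) = 0"
proof -
  let ?e = "\<lambda>y. jacobi_weight s y * gegenbauer_primitive (s + 1/2) n y"
  define \<kappa> where "\<kappa> = - (real n + 2 * s) * (real n + 1) / 2"
  have \<kappa>: "\<kappa> \<noteq> 0" using s by (auto simp: \<kappa>_def)
  let ?F = "\<lambda>y. (1 - y\<^sup>2) powr s * gegenbauer (s + 1/2) n y"
  have "((\<lambda>y. \<kappa> * ?e y) has_integral (?F 1 - ?F (-1))) {-1..1}"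
  proof (rule fundamental_theorem_of_calculus_interior)
    show "continuous_on {-1..1} ?F"
      using s by (intro continuous_on_mult continuous_on_powr' continuous_on_gegenbauer continuous_intros)
        (auto simp: abs_square_le_1 abs_le_iff)
    show "(?F has_vector_derivative \<kappa> * ?e y) (at y)" if "y \<in> {-1<..<1}" for y
      using weighted_gegenbauer_has_derivative[OF s that]
      by (simp add: \<kappa>_def has_real_derivative_iff_has_vector_derivative)
  qed auto
  then have "((\<lambda>y. \<kappa> * ?e y) has_integral 0) {-1<..<1}"
    by (simp add: has_integral_Icc_iff_Ioo)
  then have "(?e has_integral 0) {-1<..<1}"
    using \<kappa> has_integral_mult_right[of "\<lambda>y. \<kappa> * ?e y" 0 "{-1<..<1}" "1 / \<kappa>"] by simp
  moreover have "set_integrable lborel {-1<..<1} ?e"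
    using s by (intro jacobi_weight_mult_integrable continuous_on_gegenbauer_primitive) auto
  ultimately show ?thesis
    by (simp add: set_borel_integral_eq_integral(2) integral_unique)
qed

text \<open>
  The constant of integration vanishes, because both sides are orthogonal to constants.
\<close>
lemma riesz_transform_gegenbauer_primitive_from_derivative:
  assumes s: "0 < s" "s < 1"
    and der: "\<And>x. x \<in> {-1<..<1} \<Longrightarrow>
      (riesz_transform s (gegenbauer_primitive (s + 1/2) n) has_real_derivative \<nu> * (2 * gegenbauer (s + 1/2) n x)) (at x)"
    and x: "x \<in> {-1<..<1}"
  shows "riesz_transform s (gegenbauer_primitive (s + 1/2) n) x = \<nu> * gegenbauer_primitive (s + 1/2) n x"
proof -
  let ?e = "gegenbauer_primitive (s + 1/2) n"
  have a: "s + 1/2 > 0" using s by simp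
  have e: "continuous_on UNIV ?e" using a by (rule continuous_on_gegenbauer_primitive)
  have "\<exists>K. \<forall>x\<in>{-1<..<1}. riesz_transform s ?e x - \<nu> * ?e x = K"
  proof (rule has_field_derivative_zero_constant)
    show "((\<lambda>x. riesz_transform s ?e x - \<nu> * ?e x) has_real_derivative 0) (at x within {-1<..<1})"
      if "x \<in> {-1<..<1}" for x
    proof -
      have "((\<lambda>x. riesz_transform s ?e x - \<nu> * ?e x) has_real_derivative
          \<nu> * (2 * gegenbauer (s + 1/2) n x) - \<nu> * (2 * gegenbauer (s + 1/2) n x)) (at x)"
        by (intro DERIV_diff DERIV_cmult der that has_derivative_gegenbauer_primitive a)
      then show ?thesis by (simp add: has_field_derivative_at_within)
    qed
  qed auto
  then obtain K where "\<forall>x\<in>{-1<..<1}. riesz_transform s ?e x - \<nu> * ?e x = K" ..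
  then have K: "riesz_transform s ?e x = \<nu> * ?e x + K" if "x \<in> {-1<..<1}" for x
    using that by (simp add: diff_eq_eq add.commute)
  have i: "set_integrable lborel {-1<..<1} (\<lambda>x. \<nu> * (jacobi_weight s x * ?e x))"
    "set_integrable lborel {-1<..<1} (\<lambda>x. K * jacobi_weight s x)"
    using jacobi_weight_mult_integrable[OF s(1) e] jacobi_weight_integrable[OF s(1)]
    by (auto simp: jacobi_weight_def[abs_def])
  have "0 = (LBINT x:{-1<..<1}. jacobi_weight s x * riesz_transform s ?e x)"
    using riesz_transform_orthogonal_one[OF s e gegenbauer_primitive_orthogonal_one[OF s(1)]] by simp
  also have "\<dots> = (LBINT x:{-1<..<1}. \<nu> * (jacobi_weight s x * ?e x) + K * jacobi_weight s x)"
    using K by (intro set_lebesgue_integral_cong) (auto simp: algebra_simps)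
  also have "\<dots> = K * (LBINT x:{-1<..<1}. jacobi_weight s x)"
    unfolding set_integral_add(2)[OF i] by (simp add: gegenbauer_primitive_orthogonal_one[OF s(1)])
  finally have "K = 0" using jacobi_weight_integral_pos[OF s] by simp
  then show ?thesis using K[OF x] by simp
qed

lemma Beta_reflection:
  fixes s :: real assumes s: "0 < s" "s < 1"
  shows "Beta (1 - s) s = pi / sin (pi * s)"
proof -
  have 1: "Gamma (1 - complex_of_real s) = complex_of_real (Gamma (1 - s))"
    using Gamma_complex_of_real[of "1 - s"] by simp
  have 2: "sin (complex_of_real pi * complex_of_real s) = complex_of_real (sin (pi * s))"
    using sin_of_real[of "pi * s", where 'a = complex] by simp
  have "complex_of_real (Gamma s * Gamma (1 - s)) = complex_of_real (pi / sin (pi * s))"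
    using Gamma_reflection_complex[of "complex_of_real s"]
    unfolding 1 2 Gamma_complex_of_real of_real_mult of_real_divide .
  then have "Gamma s * Gamma (1 - s) = pi / sin (pi * s)" by (simp only: of_real_eq_iff)
  then show ?thesis by (simp add: Beta_def mult.commute)
qed

lemma Gamma_2s_minus_1:
  fixes s :: real assumes s: "0 < s" "s < 1" "s \<noteq> 1/2"
  shows "Gamma (2 * s - 1) \<noteq> 0" "Gamma (2 * s) = (2 * s - 1) * Gamma (2 * s - 1)"
proof -
  have "2 * s - 1 \<notin> \<int>"
  proof
    assume "2 * s - 1 \<in> \<int>"
    then obtain k :: int where k: "2 * s - 1 = of_int k" by (rule Ints_cases)
    then have "-1 < real_of_int k" "real_of_int k < 1" using s by auto
    then have "k = 0" by linarith
    with k have "2 * s - 1 = 0" by simp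
    with s(3) show False by simp
  qed
  then have "2 * s - 1 \<notin> \<int>\<^sub>\<le>\<^sub>0" using nonpos_Ints_subset_Ints by blast
  then show "Gamma (2 * s - 1) \<noteq> 0" "Gamma (2 * s) = (2 * s - 1) * Gamma (2 * s - 1)"
    using Gamma_plus1[of "2 * s - 1"] by (auto simp: Gamma_eq_zero_iff)
qed

lemma frac_const_nonzero:
  assumes s: "0 < s" "s < 1"
  shows "frac_const s \<noteq> 0"
proof -
  have "sin (pi * s) > 0" using s by (intro sin_gt_zero) auto
  then show ?thesis using Gamma_2s_minus_1(1)[OF s] by (auto simp: frac_const_def)
qed

text \<open>
  The eigenvalue $-\Gamma(2s+n)/((n+1)!\,C_s)$ of $T$ on \<open>gegenbauer_primitive (s + 1/2) n\<close>, uniformly in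
  $s$. It is normalised by the constant $C_s$ of the operator ($1/\pi$ for $s = 1/2$).
\<close>
definition riesz_eigenvalue :: "real \<Rightarrow> nat \<Rightarrow> real" where
  "riesz_eigenvalue s n = - Gamma (2 * s + real n) / (fact (Suc n) * frac_const s)"

lemma riesz_eigenvalue_Suc:
  assumes s: "0 < s" "s < 1"
  shows "(real n + 2) * riesz_eigenvalue s (Suc n) = (2 * s + real n) * riesz_eigenvalue s n"
proof -
  have "2 * s + real n \<notin> \<int>\<^sub>\<le>\<^sub>0" using s by (auto elim!: nonpos_Ints_cases)
  then have "Gamma (2 * s + real (Suc n)) = (2 * s + real n) * Gamma (2 * s + real n)"
    using Gamma_plus1[of "2 * s + real n"] by (simp add: algebra_simps)
  then show ?thesis using frac_const_nonzero[OF s]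
    by (simp add: riesz_eigenvalue_def divide_simps)
qed

lemma riesz_transform_one_has_derivative:
  assumes s: "0 < s" "s < 1" and x: "x \<in> {-1<..<1}"
  shows "(riesz_transform s (\<lambda>_. 1) has_real_derivative 0) (at x)"
proof -
  obtain c where c: "\<And>x. x \<in> {-1<..<1} \<Longrightarrow> riesz_transform s (\<lambda>_. 1) x = c"
    using riesz_transform_one[OF s] by blast
  show ?thesis
  proof (rule has_field_derivative_transform_within_open[where S = "{-1<..<1}"])
    show "((\<lambda>_. c) has_real_derivative 0) (at x)" by (rule DERIV_const)
    show "c = riesz_transform s (\<lambda>_. 1) z" if "z \<in> {-1<..<1}" for z by (rule c[OF that, symmetric])
  qed (use x in auto)
qed

text \<open>
  Induction along the three-term recurrence. The commutation rule gives the derivative of $T$ applied to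
  the next polynomial, and the recurrence of the eigenvalues cancels the term with the lower index.
\<close>
lemma riesz_transform_gegenbauer_primitive:
  assumes s: "0 < s" "s < 1" and x: "x \<in> {-1<..<1}"
  shows "riesz_transform s (gegenbauer_primitive (s + 1/2) n) x
    = riesz_eigenvalue s n * gegenbauer_primitive (s + 1/2) n x"
proof -
  define \<alpha> where "\<alpha> = s + 1/2"
  have a: "\<alpha> > 0" using s by (simp add: \<alpha>_def)
  let ?e = "gegenbauer_primitive \<alpha>" and ?C = "gegenbauer \<alpha>" and ?\<nu> = "riesz_eigenvalue s"
  have e: "continuous_on UNIV (?e k)" for k using a by (rule continuous_on_gegenbauer_primitive)
  have ye: "continuous_on UNIV (\<lambda>y. y * ?e k y)" for k by (intro continuous_on_mult continuous_on_id e)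
  have step: "(riesz_transform s (\<lambda>y. y * ?e k y) has_real_derivative
      x * (?\<nu> k * (2 * ?C k x)) + (2 * s - 1) * (?\<nu> k * ?e k x)) (at x)"
    if "\<And>x. x \<in> {-1<..<1} \<Longrightarrow> riesz_transform s (?e k) x = ?\<nu> k * ?e k x" "x \<in> {-1<..<1}" for k x
    using riesz_transform_mult_id_has_derivative[OF s e continuous_on_mult_left[OF e] that
        DERIV_cmult[OF has_derivative_gegenbauer_primitive[OF a]]]
      by (simp only: gegenbauer_primitive_orthogonal_one[OF s(1), of k, folded \<alpha>_def] if_cancel diff_zero)
  \<comment> \<open>a two-term relation between polynomials reduces the claim to one between derivatives\<close>
  have combine: "riesz_transform s (?e k) x = ?\<nu> k * ?e k x"
    if eq: "\<And>y. ?e k y = A * f y + B * g y"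
      and f: "continuous_on UNIV f" "\<And>x. x \<in> {-1<..<1} \<Longrightarrow> (riesz_transform s f has_real_derivative f' x) (at x)"
      and g: "continuous_on UNIV g" "\<And>x. x \<in> {-1<..<1} \<Longrightarrow> (riesz_transform s g has_real_derivative g' x) (at x)"
      and der: "\<And>x. x \<in> {-1<..<1} \<Longrightarrow> A * f' x + B * g' x = ?\<nu> k * (2 * ?C k x)"
      and x: "x \<in> {-1<..<1}" for k A B f g f' g' x
  proof -
    have "?e k = (\<lambda>y. A * f y + B * g y)" using eq by (rule ext)
    then have "(riesz_transform s (?e k) has_real_derivative ?\<nu> k * (2 * ?C k x)) (at x)" if "x \<in> {-1<..<1}" for x
      using riesz_transform_linear_has_derivative[OF s f(1) g(1) that f(2)[OF that] g(2)[OF that], of A B] der[OF that]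
      by simp
    from riesz_transform_gegenbauer_primitive_from_derivative[OF s this[unfolded \<alpha>_def] x]
    show ?thesis by (simp add: \<alpha>_def)
  qed
  have base: "riesz_transform s (?e 0) x = ?\<nu> 0 * ?e 0 x" if x: "x \<in> {-1<..<1}" for x
  proof -
    obtain c where c: "\<And>x. x \<in> {-1<..<1} \<Longrightarrow> riesz_transform s (\<lambda>_. 1) x = c" and cB: "s \<noteq> 1/2 \<Longrightarrow> c = Beta (1 - s) s"
      using riesz_transform_one[OF s] by blast
    \<comment> \<open>for \<open>s = 1/2\<close> the unknown constant \<open>c\<close> is multiplied by zero\<close>
    have val: "(2 * s - 1) * c - (if s = 1/2 then LBINT y:{-1<..<1}. jacobi_weight s y * 1 else 0) = riesz_eigenvalue s 0"
    proof (cases "s = 1/2")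
      case True
      have "(LBINT y:{-1<..<1}. jacobi_weight s y * 1) = pi"
        unfolding jacobi_weight_def True mult_1_right jacobi_weight_integral[OF half_gt_zero[OF zero_less_one]]
        by (simp add: Beta_def Gamma_one_half_real powr_minus powr_half_sqrt)
      then show ?thesis by (simp add: True riesz_eigenvalue_def frac_const_def)
    next
      case False
      have "sin (pi * s) > 0" using s by (intro sin_gt_zero) auto
      then show ?thesis using False Gamma_2s_minus_1[OF s False]
        by (simp add: cB Beta_reflection[OF s] riesz_eigenvalue_def frac_const_def)
    qed
    have der1: "(riesz_transform s (\<lambda>y. y * 1) has_real_derivative ?\<nu> 0) (at x)" if "x \<in> {-1<..<1}" for x
      using riesz_transform_mult_id_has_derivative[OF s continuous_on_const continuous_on_const c that, of 0]
      unfolding val[symmetric] by simp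
    show ?thesis
    proof (rule combine[where A = 2 and B = 0 and f = "\<lambda>y. y * 1" and g = "\<lambda>_. 1" and f' = "\<lambda>_. ?\<nu> 0" and g' = "\<lambda>_. 0"])
      show "?e 0 y = 2 * (y * 1) + 0 * 1" for y using a by (simp add: gegenbauer_primitive_0)
      show "continuous_on UNIV (\<lambda>y::real. y * 1)" by (intro continuous_intros)
    qed (use x der1 riesz_transform_one_has_derivative[OF s] in simp_all)
  qed
  have "riesz_transform s (?e n) x = ?\<nu> n * ?e n x" using x
  proof (induction n arbitrary: x rule: induct_nat_012)
    case 0
    then show ?case by (rule base)
  next
    case 1
    show ?case
    proof (rule combine[where A = \<alpha> and B = "-1" and f = "\<lambda>y. y * ?e 0 y" and g = "\<lambda>_. 1" and
          f' = "\<lambda>x. x * (?\<nu> 0 * (2 * ?C 0 x)) + (2 * s - 1) * (?\<nu> 0 * ?e 0 x)" and g' = "\<lambda>_. 0",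
          OF _ ye step[OF base] continuous_on_const riesz_transform_one_has_derivative[OF s] _ 1])
      show "?e (Suc 0) y = \<alpha> * (y * ?e 0 y) + (-1) * 1" for y
        using gegenbauer_primitive_1[OF a] by simp
      show "\<alpha> * (x * (?\<nu> 0 * (2 * ?C 0 x)) + (2 * s - 1) * (?\<nu> 0 * ?e 0 x)) + (-1) * 0 = ?\<nu> (Suc 0) * (2 * ?C (Suc 0) x)" for x
        using riesz_eigenvalue_Suc[OF s, of 0] gegenbauer_primitive_0[OF a, of x]
        by (simp add: algebra_simps)
    qed
  next
    case (ge2 n)
    have n3: "real n + 3 > 0" by simp
    show ?case
    proof (rule combine[where A = "2 * (real n + 1 + \<alpha>) / (real n + 3)" and B = "- (real n + 2 * \<alpha> - 1) / (real n + 3)"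
          and f = "\<lambda>y. y * ?e (Suc n) y" and g = "?e n" and g' = "\<lambda>x. ?\<nu> n * (2 * ?C n x)" and
          f' = "\<lambda>x. x * (?\<nu> (Suc n) * (2 * ?C (Suc n) x)) + (2 * s - 1) * (?\<nu> (Suc n) * ?e (Suc n) x)",
          OF _ ye step[OF ge2(2)] e _ _ ge2(3)])
      show "(riesz_transform s (?e n) has_real_derivative ?\<nu> n * (2 * ?C n x)) (at x)" if "x \<in> {-1<..<1}" for x
        by (rule has_field_derivative_transform_within_open[where S = "{-1<..<1}",
              OF DERIV_cmult[OF has_derivative_gegenbauer_primitive[OF a]]])
           (use that ge2(1) in auto)
      show "?e (Suc (Suc n)) y = 2 * (real n + 1 + \<alpha>) / (real n + 3) * (y * ?e (Suc n) y)
          + (- (real n + 2 * \<alpha> - 1) / (real n + 3)) * ?e n y" for y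
        using gegenbauer_primitive_rec[OF a, of n y] n3 by (simp add: divide_simps) (simp add: algebra_simps)
      fix x :: real
      have 1: "(real n + 3) * ?\<nu> (Suc (Suc n)) = (real n + 1 + 2 * s) * ?\<nu> (Suc n)"
        "(real n + 2) * ?\<nu> (Suc n) = (real n + 2 * s) * ?\<nu> n"
        using riesz_eigenvalue_Suc[OF s, of "Suc n"] riesz_eigenvalue_Suc[OF s, of n] by (simp_all add: algebra_simps)
      have 2: "(real n + 1 + \<alpha>) * ?e (Suc n) x = ?C (Suc (Suc n)) x - ?C n x"
        unfolding gegenbauer_primitive_Suc using a by (simp del: gegenbauer.simps)
      have 3: "(real n + 2) * ?C (Suc (Suc n)) x = 2 * x * (real n + 1 + \<alpha>) * ?C (Suc n) x - (real n + 2 * \<alpha>) * ?C n x"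
        using gegenbauer_rec[of n \<alpha> x] by (simp add: add.commute del: gegenbauer.simps)
      have 4: "\<alpha> = s + 1/2" by (rule \<alpha>_def)
      have "2 * (real n + 1 + \<alpha>) * (x * (?\<nu> (Suc n) * (2 * ?C (Suc n) x)) + (2 * s - 1) * (?\<nu> (Suc n) * ?e (Suc n) x))
          - (real n + 2 * \<alpha> - 1) * (?\<nu> n * (2 * ?C n x))
         = (real n + 3) * (?\<nu> (Suc (Suc n)) * (2 * ?C (Suc (Suc n)) x))" (is "?L = ?R")
      proof -
        have "?L = 2 * ?\<nu> (Suc n) * (2 * x * (real n + 1 + \<alpha>) * ?C (Suc n) x)
            + 2 * (2 * s - 1) * ?\<nu> (Suc n) * ((real n + 1 + \<alpha>) * ?e (Suc n) x)
            - 2 * ((real n + 2 * s) * ?\<nu> n) * ?C n x"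
          unfolding 4 by (simp add: algebra_simps del: gegenbauer.simps)
        also have "2 * x * (real n + 1 + \<alpha>) * ?C (Suc n) x = (real n + 2) * ?C (Suc (Suc n)) x + (real n + 1 + 2 * s) * ?C n x"
          using 3 unfolding 4 by (simp add: algebra_simps del: gegenbauer.simps)
        also have "2 * ?\<nu> (Suc n) * ((real n + 2) * ?C (Suc (Suc n)) x + (real n + 1 + 2 * s) * ?C n x)
            + 2 * (2 * s - 1) * ?\<nu> (Suc n) * ((real n + 1 + \<alpha>) * ?e (Suc n) x)
            - 2 * ((real n + 2 * s) * ?\<nu> n) * ?C n x = 2 * ((real n + 1 + 2 * s) * ?\<nu> (Suc n)) * ?C (Suc (Suc n)) x"
          unfolding 2 1(2)[symmetric] by (simp add: algebra_simps del: gegenbauer.simps)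
        also have "\<dots> = ?R" unfolding 1(1)[symmetric] by (simp only: mult_ac)
        finally show ?thesis .
      qed
      moreover have "a / d * u + (- b / d) * v = w" if "a * u - b * v = d * w" "d > 0" for a b d u v w :: real
        using that by (simp add: field_simps)
      ultimately show "2 * (real n + 1 + \<alpha>) / (real n + 3) * (x * (?\<nu> (Suc n) * (2 * ?C (Suc n) x)) + (2 * s - 1) * (?\<nu> (Suc n) * ?e (Suc n) x))
          + (- (real n + 2 * \<alpha> - 1) / (real n + 3)) * (?\<nu> n * (2 * ?C n x))
         = ?\<nu> (Suc (Suc n)) * (2 * ?C (Suc (Suc n)) x)"
        using n3 by blast
    qed
  qed
  then show ?thesis by (simp add: \<alpha>_def)
qed

section \<open>The weighted operator on an arbitrary interval\<close>

lemma frac_kernel_scale: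
  assumes "c > 0"
  shows "frac_kernel s (c * z) = c powr (1 - 2 * s) * frac_kernel s z + (if s = 1/2 \<and> z \<noteq> 0 then ln c else 0)"
proof (cases "s = 1/2")
  case True
  then show ?thesis unfolding frac_kernel_def True using assms by (simp add: abs_mult ln_mult)
next
  case False
  then show ?thesis using assms by (simp add: frac_kernel_def abs_mult powr_mult)
qed

text \<open>
  Here $c$ and $m$ are the half-length and the midpoint of the interval, so that $y = m + ct$ maps $(-1,1)$
  onto $(a,b)$.
\<close>
lemma edge_weight_gegenbauer_has_derivative:
  fixes s a b y :: real
  assumes s: "0 < s" and ab: "a < b" and y: "y \<in> {a<..<b}"
  defines "c \<equiv> (b - a) / 2" and "m \<equiv> (a + b) / 2"
  shows "((\<lambda>y. edge_weight s a b y * gegenbauer (s + 1/2) n (2 * (y - a) / (b - a) - 1)) has_real_derivative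
     c powr (2 * s - 1) * (- (real n + 2 * s) * (real n + 1) / 2)
       * (jacobi_weight s ((y - m) / c) * gegenbauer_primitive (s + 1/2) n ((y - m) / c))) (at y)"
proof (rule has_field_derivative_transform_within_open[where S = "{a<..<b}"])
  let ?G = "\<lambda>t. (1 - t\<^sup>2) powr s * gegenbauer (s + 1/2) n t"
  let ?D = "\<lambda>t. - (real n + 2 * s) * (real n + 1) / 2 * (jacobi_weight s t * gegenbauer_primitive (s + 1/2) n t)"
  have c: "c > 0" using ab by (simp add: c_def)
  have t: "(z - m) / c \<in> {-1<..<1}" if "z \<in> {a<..<b}" for z
    using that ab by (auto simp: c_def m_def field_simps)
  have "((\<lambda>z. (z - m) / c) has_real_derivative 1 / c) (at y)"
    using c by (auto intro!: derivative_eq_intros)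
  from DERIV_chain2[where f = ?G and g = "\<lambda>z. (z - m) / c", OF weighted_gegenbauer_has_derivative[OF s t[OF y]] this]
  have "((\<lambda>z. c powr (2 * s) * ?G ((z - m) / c)) has_real_derivative c powr (2 * s) * (?D ((y - m) / c) * (1 / c))) (at y)"
    by (rule DERIV_cmult)
  moreover have pc: "c powr (2 * s - 1) = c powr (2 * s) * (1 / c)" using c by (simp add: powr_diff)
  ultimately show "((\<lambda>z. c powr (2 * s) * ?G ((z - m) / c)) has_real_derivative
      c powr (2 * s - 1) * (- (real n + 2 * s) * (real n + 1) / 2)
       * (jacobi_weight s ((y - m) / c) * gegenbauer_primitive (s + 1/2) n ((y - m) / c))) (at y)"
    unfolding pc by (simp only: mult_ac)
  show "c powr (2 * s) * ?G ((z - m) / c) = edge_weight s a b z * gegenbauer (s + 1/2) n (2 * (z - a) / (b - a) - 1)"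
    if z: "z \<in> {a<..<b}" for z
  proof -
    have 1: "2 * (z - a) / (b - a) - 1 = (z - m) / c"
      using ab by (simp add: c_def m_def field_simps)
    have 2: "z - a = c * (1 + (z - m) / c)" "b - z = c * (1 - (z - m) / c)"
      using c by (simp_all add: field_simps) (simp_all add: c_def m_def field_simps)
    have "edge_weight s a b z = c powr (2 * s) * ((1 + (z - m) / c) * (1 - (z - m) / c)) powr s"
      unfolding edge_weight_def 2 using t[OF z] c powr_add[of c s s]
      by (simp add: powr_mult)
    also have "(1 + (z - m) / c) * (1 - (z - m) / c) = 1 - ((z - m) / c)\<^sup>2"
      by (simp add: power2_eq_square algebra_simps)
    finally show ?thesis unfolding 1 by simp
  qed
qed (use y in auto)

text \<open>
  Under $y = m + ct$ the kernel, the weight and $dy$ scale with total exponent $(1-2s) + (2s-1) + 1 = 1$.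
  For the logarithm the extra term $\ln c$ is integrated against a function orthogonal to constants.
\<close>
lemma frac_potential_gegenbauer:
  fixes s a b x :: real and n :: nat
  assumes s: "0 < s" "s < 1" and ab: "a < b" and x: "x \<in> {a<..<b}"
  defines "c \<equiv> (b - a) / 2" and "m \<equiv> (a + b) / 2"
    and "p \<equiv> (\<lambda>x. gegenbauer (s + 1/2) n (2 * (x - a) / (b - a) - 1))"
  shows "set_integrable lborel {a<..<b}
      (\<lambda>y. frac_kernel s (x - y) * deriv (\<lambda>y. edge_weight s a b y * p y) y)" (is ?int)
    and "frac_potential s a b p x = c * (- (real n + 2 * s) * (real n + 1) / 2)
      * (riesz_eigenvalue s n * gegenbauer_primitive (s + 1/2) n ((x - m) / c))" (is ?val)
proof -
  define \<kappa> where "\<kappa> = - (real n + 2 * s) * (real n + 1) / 2"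
  define e where "e = gegenbauer_primitive (s + 1/2) n"
  define \<xi> where "\<xi> = (x - m) / c"
  define K where "K = c powr (2 * s - 1) * \<kappa>"
  have c: "c > 0" using ab by (simp add: c_def)
  have \<xi>: "\<xi> \<in> {-1<..<1}" using x ab by (auto simp: \<xi>_def c_def m_def field_simps)
  have ec: "continuous_on UNIV e" unfolding e_def using s by (intro continuous_on_gegenbauer_primitive) auto
  have [measurable]: "e \<in> borel_measurable borel" using ec by (rule borel_measurable_continuous_onI)
  define f where "f y = indicator {a<..<b} y *\<^sub>R (frac_kernel s (x - y) * deriv (\<lambda>y. edge_weight s a b y * p y) y)" for y
  define H where "H t = indicator {-1<..<1} t *\<^sub>R (K * c powr (1 - 2 * s) * (frac_kernel s (\<xi> - t) * (jacobi_weight s t * e t)))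
      + indicator {-1<..<1} t *\<^sub>R (K * (if s = 1/2 then ln c else 0) * (jacobi_weight s t * e t))" for t
  have mem: "m + c * t \<in> {a<..<b} \<longleftrightarrow> t \<in> {-1<..<1}" for t
  proof -
    have "m + c * t - a = c * (1 + t)" "b - (m + c * t) = c * (1 - t)"
      by (simp_all add: c_def m_def field_simps)
    then have "a < m + c * t \<longleftrightarrow> 0 < c * (1 + t)" "m + c * t < b \<longleftrightarrow> 0 < c * (1 - t)"
      by linarith+
    then show ?thesis using c by (auto simp: zero_less_mult_iff)
  qed
  have fH: "f (m + c * t) = H t" if t: "t \<noteq> \<xi>" for t
  proof (cases "t \<in> {-1<..<1}")
    case True
    then have y: "m + c * t \<in> {a<..<b}" by (simp only: mem)
    have d: "deriv (\<lambda>y. edge_weight s a b y * p y) (m + c * t) = K * (jacobi_weight s t * e t)"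
      using DERIV_imp_deriv[OF edge_weight_gegenbauer_has_derivative[OF s(1) ab y, of n]] c
      by (simp add: p_def K_def \<kappa>_def e_def c_def m_def)
    have "x - (m + c * t) = c * (\<xi> - t)" using c by (simp add: \<xi>_def field_simps)
    then have k: "frac_kernel s (x - (m + c * t)) = c powr (1 - 2 * s) * frac_kernel s (\<xi> - t) + (if s = 1/2 then ln c else 0)"
      using frac_kernel_scale[OF c, of s "\<xi> - t"] t by simp
    show ?thesis
      unfolding f_def H_def d k using True y by (simp add: algebra_simps)
  next
    case False
    then have "m + c * t \<notin> {a<..<b}" unfolding mem .
    with False show ?thesis by (simp add: f_def H_def)
  qed
  have H1: "integrable lborel (\<lambda>t. indicator {-1<..<1} t *\<^sub>R (K * c powr (1 - 2 * s) * (frac_kernel s (\<xi> - t) * (jacobi_weight s t * e t))))"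
    using set_integrable_mult_right[OF riesz_transform_integrable[OF s ec \<xi>]] by (simp add: set_integrable_def)
  have H2: "integrable lborel (\<lambda>t. indicator {-1<..<1} t *\<^sub>R (K * (if s = 1/2 then ln c else 0) * (jacobi_weight s t * e t)))"
    using set_integrable_mult_right[OF jacobi_weight_mult_integrable[OF s(1) ec]] unfolding set_integrable_def by blast
  have Hi: "integrable lborel H" unfolding H_def using H1 H2 by (rule Bochner_Integration.integrable_add)
  have "(LBINT t:{-1<..<1}. K * (if s = 1/2 then ln c else 0) * (jacobi_weight s t * e t)) = 0"
    using gegenbauer_primitive_orthogonal_one[OF s(1), of n, folded e_def] by (simp only: set_integral_mult_right mult_zero_right)
  moreover have "(LBINT t:{-1<..<1}. K * c powr (1 - 2 * s) * (frac_kernel s (\<xi> - t) * (jacobi_weight s t * e t))) = K * c powr (1 - 2 * s) * riesz_transform s e \<xi>"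
    unfolding riesz_transform_def by (rule set_integral_mult_right)
  ultimately have "integral\<^sup>L lborel H = K * c powr (1 - 2 * s) * riesz_transform s e \<xi>"
    unfolding H_def Bochner_Integration.integral_add[OF H1 H2]
    by (simp only: set_lebesgue_integral_def add_0_right)
  also have "K * c powr (1 - 2 * s) = \<kappa>"
  proof -
    have "c powr (2 * s - 1) * c powr (1 - 2 * s) = 1" using c by (simp flip: powr_add)
    then show ?thesis by (simp add: K_def mult_ac)
  qed
  also have "riesz_transform s e \<xi> = riesz_eigenvalue s n * e \<xi>"
    unfolding e_def by (rule riesz_transform_gegenbauer_primitive[OF s \<xi>])
  finally have HI: "integral\<^sup>L lborel H = \<kappa> * (riesz_eigenvalue s n * e \<xi>)" .
  \<comment> \<open>At \<open>t = \<xi>\<close> the default value of the logarithm at 0 breaks the scaling; one point does not matter.\<close>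
  define h where "h t = (if t = \<xi> then f (m + c * \<xi>) else H t)" for t
  have fh: "(\<lambda>t. f (m + c * t)) = h" using fH by (auto simp: h_def)
  have Hm [measurable]: "H \<in> borel_measurable lborel" using Hi by (rule borel_measurable_integrable)
  have hm: "h \<in> borel_measurable lborel" unfolding h_def[abs_def] by measurable
  have hH: "AE t in lborel. h t = H t"
    using AE_lborel_singleton[of \<xi>] by eventually_elim (simp add: h_def)
  have hi: "integrable lborel h"
    using Hi integrable_cong_AE[OF hm Hm hH] by blast
  have hI: "integral\<^sup>L lborel h = integral\<^sup>L lborel H"
    by (rule integral_cong_AE[OF hm Hm hH])
  show ?int
    using hi lborel_integrable_real_affine_iff[of c f m] c unfolding fh by (simp add: set_integrable_def f_def[abs_def])
  have "frac_potential s a b p x = integral\<^sup>L lborel f"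
    by (simp add: frac_potential_def set_lebesgue_integral_def f_def[abs_def])
  also have "\<dots> = c * integral\<^sup>L lborel H"
    using lborel_integral_real_affine[of c f m] c unfolding fh hI by simp
  finally show ?val by (simp add: HI \<kappa>_def e_def \<xi>_def mult.assoc)
qed

lemma frac_const_riesz_eigenvalue:
  assumes s: "0 < s" "s < 1"
  shows "frac_const s * (- (real n + 2 * s) * (real n + 1) * riesz_eigenvalue s n) = frac_eigenvalue s n"
proof -
  have "2 * s + real n \<notin> \<int>\<^sub>\<le>\<^sub>0" using s by (auto elim!: nonpos_Ints_cases)
  then have "Gamma (2 * s + real n + 1) = (2 * s + real n) * Gamma (2 * s + real n)"
    by (rule Gamma_plus1)
  then show ?thesis using frac_const_nonzero[OF s]
    by (simp add: riesz_eigenvalue_def frac_eigenvalue_def add.commute[of "real n"] divide_simps)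
      (simp add: algebra_simps)
qed

lemma weighted_frac_laplacian_gegenbauer:
  fixes s a b :: real and n :: nat
  assumes s: "0 < s" "s < 1" and ab: "a < b"
  defines "p \<equiv> (\<lambda>x. gegenbauer (s + 1/2) n (2 * (x - a) / (b - a) - 1))"
  shows "weighted_frac_laplacian_defined s a b p"
    and "\<And>x. x \<in> {a<..<b} \<Longrightarrow> weighted_frac_laplacian s a b p x = frac_eigenvalue s n * p x"
proof -
  define c where "c = (b - a) / 2"
  define m where "m = (a + b) / 2"
  have c: "c > 0" using ab by (simp add: c_def)
  have px: "p x = gegenbauer (s + 1/2) n ((x - m) / c)" for x
  proof -
    have "2 * (x - a) / (b - a) - 1 = (x - m) / c"
      using ab by (simp add: c_def m_def field_simps)
    then show ?thesis by (simp add: p_def)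
  qed
  have der: "(frac_potential s a b p has_real_derivative
      - (real n + 2 * s) * (real n + 1) * riesz_eigenvalue s n * p x) (at x)" if x: "x \<in> {a<..<b}" for x
  proof (rule has_field_derivative_transform_within_open[where S = "{a<..<b}"])
    let ?A = "c * (- (real n + 2 * s) * (real n + 1) / 2)" and ?e = "gegenbauer_primitive (s + 1/2) n"
    have a: "s + 1/2 > 0" using s by simp
    have "((\<lambda>z. (z - m) / c) has_real_derivative 1 / c) (at x)"
      using c by (auto intro!: derivative_eq_intros)
    from DERIV_cmult[OF DERIV_cmult[OF DERIV_chain2[where f = ?e and g = "\<lambda>z. (z - m) / c",
        OF has_derivative_gegenbauer_primitive[OF a] this]], of ?A "riesz_eigenvalue s n"]
    show "((\<lambda>z. ?A * (riesz_eigenvalue s n * ?e ((z - m) / c))) has_real_derivative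
       - (real n + 2 * s) * (real n + 1) * riesz_eigenvalue s n * p x) (at x)"
      by (rule DERIV_cong) (use c in \<open>simp add: px\<close>)
    show "?A * (riesz_eigenvalue s n * ?e ((z - m) / c)) = frac_potential s a b p z" if "z \<in> {a<..<b}" for z
      unfolding c_def m_def p_def by (rule frac_potential_gegenbauer(2)[OF s ab that, symmetric])
  qed (use x in auto)
  show "weighted_frac_laplacian_defined s a b p"
    unfolding weighted_frac_laplacian_defined_def
  proof (intro conjI ballI)
    fix y assume y: "y \<in> {a<..<b}"
    show "(\<lambda>y. edge_weight s a b y * p y) field_differentiable at y"
      unfolding field_differentiable_def p_def using edge_weight_gegenbauer_has_derivative[OF s(1) ab y] by blast
    show "set_integrable lborel {a<..<b} (\<lambda>z. frac_kernel s (y - z) * deriv (\<lambda>y. edge_weight s a b y * p y) z)"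
      unfolding p_def by (rule frac_potential_gegenbauer(1)[OF s ab y])
    show "frac_potential s a b p field_differentiable at y"
      unfolding field_differentiable_def using der[OF y] by blast
  qed
  fix x assume x: "x \<in> {a<..<b}"
  show "weighted_frac_laplacian s a b p x = frac_eigenvalue s n * p x"
    unfolding weighted_frac_laplacian_def DERIV_imp_deriv[OF der[OF x]]
      frac_const_riesz_eigenvalue[OF s, symmetric] by (simp only: mult_ac)
qed

theorem corollary3p15:
  fixes s :: real and n :: nat
  assumes "0 < s" and "s < 1"
  shows "(weighted_frac_laplacian_defined s (-1) 1 (gegenbauer (s + 1/2) n) \<and>
          (\<forall>x\<in>{-1<..<1}.
             weighted_frac_laplacian s (-1) 1 (gegenbauer (s + 1/2) n) x
             = frac_eigenvalue s n * gegenbauer (s + 1/2) n x)) \<and>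
         (\<forall>(a::real) b::real. a < b \<longrightarrow>
           (let p = (\<lambda>x. gegenbauer (s + 1/2) n (2 * (x - a) / (b - a) - 1)) in
              weighted_frac_laplacian_defined s a b p \<and>
              (\<forall>x\<in>{a<..<b}.
                 weighted_frac_laplacian s a b p x = frac_eigenvalue s n * p x)))"
proof -
  have "2 * (x - (-1)) / (1 - (-1)) - 1 = x" for x :: real by (simp add: field_simps)
  then have eq: "(\<lambda>x::real. gegenbauer (s + 1/2) n (2 * (x - (-1)) / (1 - (-1)) - 1)) = gegenbauer (s + 1/2) n"
    by (simp only:)
  have lt: "- 1 < (1::real)" by simp
  have "weighted_frac_laplacian_defined s (-1) 1 (gegenbauer (s + 1/2) n) \<and>
      (\<forall>x\<in>{-1<..<1}. weighted_frac_laplacian s (-1) 1 (gegenbauer (s + 1/2) n) x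
         = frac_eigenvalue s n * gegenbauer (s + 1/2) n x)"
    using weighted_frac_laplacian_gegenbauer[OF assms lt, where n = n] unfolding eq fun_cong[OF eq] by blast
  moreover have "\<forall>(a::real) b::real. a < b \<longrightarrow>
           (let p = (\<lambda>x. gegenbauer (s + 1/2) n (2 * (x - a) / (b - a) - 1)) in
              weighted_frac_laplacian_defined s a b p \<and>
              (\<forall>x\<in>{a<..<b}.
                 weighted_frac_laplacian s a b p x = frac_eigenvalue s n * p x))"
    unfolding Let_def using weighted_frac_laplacian_gegenbauer[OF assms, where n = n] by blast
  ultimately show ?thesis by blast
qed

end
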